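(* Fix $b>0$ and $\underline{\pi}\in(0,1/2)$, and let $\mathcal{F}=\mathcal{M}_1\cup\mathcal{M}_2$ and the post-selection estimator $\tilde f_n=\hat f_{\hat k_n,n}$ with penalties $\mathrm{pen}_{1,n},\mathrm{pen}_{2,n}$ be as defined in the context. Put $\Delta_n=\mathrm{pen}_{2,n}-\mathrm{pen}_{1,n}$. If $\Delta_n\to0$ and $n\Delta_n\to\infty$ as $n\to\infty$, then there exists a constant $c>0$, depending only on $b$ and $\underline{\pi}$, such that for all sufficiently large $n$, $$\sup_{f_0\in\mathcal{F}}\mathrm{E}_{f_0}\big\{\mathfrak{h}^2(\tilde f_n,f_0)\big\}\ge c\,\Delta_n.$$
   Context: $\phi(x;\mu)=(2\pi)^{-1/2}\exp\{-(x-\mu)^2/2\}$ is the density of $\mathrm{N}(\mu,1)$ on $\mathbb{R}$ (with respect to Lebesgue measure). $\mathcal{M}_1=\{\phi(\cdot;\mu):\mu\in[-b,b]\}$ and $$\mathcal{M}_2=\{\pi\phi(\cdot;\mu_1)+(1-\pi)\phi(\cdot;\mu_2):\pi\in[\underline{\pi},1-\underline{\pi}],\ \mu_1,\mu_2\in[-b,b],\ \mu_1\le\mu_2\}.$$ $X_1,\dots,X_n$ are IID with Lebesgue density $f_0\in\mathcal{F}$; $\mathrm{E}_{f_0}$ denotes expectation under this law. $\ell_n(f)=-n^{-1}\sum_{i=1}^n\log f(X_i)$, and for $k\in\{1,2\}$, $\hat f_{k,n}\in\arg\min_{f\in\mathcal{M}_k}\ell_n(f)$ is a maximum likelihood estimator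 over $\mathcal{M}_k$. For deterministic real penalties $\mathrm{pen}_{k,n}$, $$\hat k_n=\min\ \underset{k\in\{1,2\}}{\arg\min}\{\ell_n(\hat f_{k,n})+\mathrm{pen}_{k,n}\},\qquad \tilde f_n=\hat f_{\hat k_n,n}.$$ Hellinger divergence: $\mathfrak{h}(f,g)=\{\frac12\int(f^{1/2}-g^{1/2})^2\,\mathrm{d}x\}^{1/2}$. All random quantities of interest are assumed measurable. *)

theory Defs
  imports "HOL-Probability.Probability"
begin

definition M1 :: "real \<Rightarrow> (real \<Rightarrow> real) set" where
  "M1 b = {normal_density \<mu> 1 | \<mu>. \<mu> \<in> {-b..b}}"

definition M2 :: "real \<Rightarrow> real \<Rightarrow> (real \<Rightarrow> real) set" where
  "M2 b p = {(\<lambda>x. \<pi> * normal_density \<mu>1 1 x + (1 - \<pi>) * normal_density \<mu>2 1 x) | \<pi> \<mu>1 \<mu>2.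
     \<pi> \<in> {p..1 - p} \<and> \<mu>1 \<in> {-b..b} \<and> \<mu>2 \<in> {-b..b} \<and> \<mu>1 \<le> \<mu>2}"

(* Only the indices 1 and 2 are ever used. *)
definition model :: "real \<Rightarrow> real \<Rightarrow> nat \<Rightarrow> (real \<Rightarrow> real) set" where
  "model b p k = (if k = 1 then M1 b else M2 b p)"

definition hellinger :: "(real \<Rightarrow> real) \<Rightarrow> (real \<Rightarrow> real) \<Rightarrow> real" where
  "hellinger f g = sqrt (1 / 2 * (\<integral>x. (sqrt (f x) - sqrt (g x))\<^sup>2 \<partial>lborel))"

(* Samples of size n are points x = (x 1, ..., x n) of the product space over {1..n}. *)
definition sample_law :: "(real \<Rightarrow> real) \<Rightarrow> nat \<Rightarrow> (nat \<Rightarrow> real) measure" where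
  "sample_law f n = (\<Pi>\<^sub>M i\<in>{1..n}. density lborel (\<lambda>x. ennreal (f x)))"

definition sample_space :: "nat \<Rightarrow> (nat \<Rightarrow> real) measure" where
  "sample_space n = (\<Pi>\<^sub>M i\<in>{1..n}. (borel :: real measure))"

definition neg_loglik :: "nat \<Rightarrow> (nat \<Rightarrow> real) \<Rightarrow> (real \<Rightarrow> real) \<Rightarrow> real" where
  "neg_loglik n x f = - (1 / real n) * (\<Sum>i=1..n. ln (f (x i)))"

(* An estimator sequence for each model: fhat k n x is the density estimate
   in the k-th model computed from the sample x of size n. *)
type_synonym estimators = "nat \<Rightarrow> nat \<Rightarrow> (nat \<Rightarrow> real) \<Rightarrow> (real \<Rightarrow> real)"

definition is_mle :: "real \<Rightarrow> real \<Rightarrow> estimators \<Rightarrow> bool" where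
  "is_mle b p fhat \<longleftrightarrow>
     (\<forall>k\<in>{1, 2}. \<forall>n\<ge>1. \<forall>x \<in> space (sample_space n).
        is_arg_min (neg_loglik n x) (\<lambda>f. f \<in> model b p k) (fhat k n x))"

definition khat :: "(nat \<Rightarrow> nat \<Rightarrow> real) \<Rightarrow> estimators \<Rightarrow> nat \<Rightarrow> (nat \<Rightarrow> real) \<Rightarrow> nat" where
  "khat pen fhat n x =
     Min {k. is_arg_min (\<lambda>k. neg_loglik n x (fhat k n x) + pen k n) (\<lambda>k. k \<in> {1, 2}) k}"

definition post_selection :: "(nat \<Rightarrow> nat \<Rightarrow> real) \<Rightarrow> estimators \<Rightarrow> nat \<Rightarrow> (nat \<Rightarrow> real) \<Rightarrow> (real \<Rightarrow> real)" where
  "post_selection pen fhat n x = fhat (khat pen fhat n x) n x"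

definition risk :: "(nat \<Rightarrow> nat \<Rightarrow> real) \<Rightarrow> estimators \<Rightarrow> nat \<Rightarrow> (real \<Rightarrow> real) \<Rightarrow> real" where
  "risk pen fhat n f0 = (\<integral>x. (hellinger (post_selection pen fhat n x) f0)\<^sup>2 \<partial>sample_law f0 n)"

(* The selected index and the loss are genuine random variables; in particular the
   Bochner integral defining the risk is not the default value 0 of a nonmeasurable integrand. *)
definition measurable_selection :: "real \<Rightarrow> real \<Rightarrow> (nat \<Rightarrow> nat \<Rightarrow> real) \<Rightarrow> estimators \<Rightarrow> bool" where
  "measurable_selection b p pen fhat \<longleftrightarrow>
     (\<forall>n\<ge>1. khat pen fhat n \<in> measurable (sample_space n) (count_space UNIV) \<and>
        (\<forall>f0 \<in> M1 b \<union> M2 b p.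
           (\<lambda>x. (hellinger (post_selection pen fhat n x) f0)\<^sup>2) \<in> borel_measurable (sample_space n)))"

end

theory Submission
  imports Defs
begin

text \<open>
  The least favourable truth is the symmetric mixture \<open>f0\<close> of \<open>N(-t,1)\<close> and \<open>N(t,1)\<close> with \<open>t^4\<close> a small
  multiple of the penalty difference \<open>\<Delta>\<close>. Mean and third moment agree with those of \<open>N(0,1)\<close>, so a change
  of order \<open>t\<^sup>2\<close> in the variance is all that separates \<open>f0\<close> from the smaller model: its squared Hellinger
  distance to \<open>M1\<close> is at least a multiple of \<open>t^4\<close>. It therefore suffices that the smaller model is
  selected with probability at least \<open>1/2\<close> under \<open>f0\<close>.

  For \<open>f\<close> in \<open>M2\<close> with mean \<open>m\<close> and second moment \<open>s\<close> of the mixing distribution, put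
  \<open>u = f / \<phi>(.;0) - 1\<close>. Then \<open>ln (1 + u) \<le> u\<close>, with a gain of order \<open>u\<^sup>2\<close> on bounded sets, and on one
  of three fixed windows \<open>u\<^sup>2\<close> is at least a multiple of \<open>m\<^sup>2 + s\<^sup>2\<close>. Expanding the exponentials in power
  series, the sum of \<open>u(X_i)\<close> is at most \<open>n s t\<^sup>2 + (\<bar>m\<bar> + s) V\<close> up to constants, where \<open>V\<close> is a weighted
  sum of the deviations of all empirical moments and has mean of order \<open>sqrt n\<close>. Completing squares bounds
  the log-likelihood ratio, uniformly over \<open>M2\<close>, by a multiple of \<open>n t^4 + V\<^sup>2 / n\<close>, which is below \<open>n \<Delta>\<close>
  because \<open>n \<Delta>\<close> diverges.
\<close>

section \<open>Likelihood ratios of normal mixtures\<close>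

text \<open>The density of N(\<mu>,1) relative to N(0,1); in \<mu> it is the exponential generating
  function of the Hermite polynomials.\<close>

definition tilt :: "real \<Rightarrow> real \<Rightarrow> real" where
  "tilt \<mu> x = exp (\<mu> * x - \<mu>\<^sup>2 / 2)"

lemma tilt_pos [simp]: "tilt \<mu> x > 0"
  by (simp add: tilt_def)

lemma normal_density_tilt: "normal_density \<mu> 1 x = tilt \<mu> x * normal_density 0 1 x"
proof -
  have "- (x - \<mu>)\<^sup>2 / 2 = (\<mu> * x - \<mu>\<^sup>2 / 2) + (- x\<^sup>2 / 2)"
    by (simp add: power2_eq_square field_simps)
  then show ?thesis
    by (simp add: normal_density_def tilt_def flip: exp_add)
qed

text \<open>The gap \<open>g\<close> between the sides has derivative
  \<open>(y - 1) * (R - y) / (y * R)\<close>, so on (0,R] it is smallest at 1, where it vanishes.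
  This supplies the quadratic gain over \<open>ln r \<le> r - 1\<close>.\<close>

lemma ln_le_quadratic:
  fixes r R :: real
  assumes "0 < r" "r \<le> R" "1 \<le> R"
  shows "ln r \<le> (r - 1) - (r - 1)\<^sup>2 / (2 * R)"
proof -
  define g where "g y = (y - 1) - (y - 1)\<^sup>2 / (2 * R) - ln y" for y :: real
  have g': "(g has_real_derivative (y - 1) * (R - y) / (y * R)) (at y)" if "y > 0" for y
    unfolding g_def using that \<open>1 \<le> R\<close>
    by (auto intro!: derivative_eq_intros simp: field_simps power2_eq_square)
  have "g 1 \<le> g r"
  proof (cases "1 \<le> r")
    case True
    show ?thesis
    proof (rule DERIV_nonneg_imp_nondecreasing[OF True])
      fix y assume "1 \<le> y" "y \<le> r"
      then show "\<exists>d. (g has_real_derivative d) (at y) \<and> 0 \<le> d"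
        using g'[of y] assms by (intro exI[of _ "(y - 1) * (R - y) / (y * R)"]) auto
    qed
  next
    case False
    then have "r \<le> 1" by simp
    then show ?thesis
    proof (rule DERIV_nonpos_imp_nonincreasing)
      fix y assume "r \<le> y" "y \<le> 1"
      then show "\<exists>d. (g has_real_derivative d) (at y) \<and> d \<le> 0"
        using g'[of y] assms
        by (intro exI[of _ "(y - 1) * (R - y) / (y * R)"])
           (auto intro!: divide_nonpos_pos mult_nonpos_nonneg)
    qed
  qed
  then show ?thesis by (simp add: g_def)
qed

lemma exp_minus_linear_le: "exp z - 1 - z \<le> z\<^sup>2 / 2 * exp \<bar>z\<bar>" for z :: real
proof -
  obtain t where t: "\<bar>t\<bar> \<le> \<bar>z\<bar>" "exp z = (\<Sum>m<2. z ^ m / fact m) + exp t / fact 2 * z ^ 2"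
    using Maclaurin_exp_le by blast
  have "exp t * z\<^sup>2 \<le> exp \<bar>z\<bar> * z\<^sup>2"
    using t(1) by (intro mult_right_mono) auto
  then show ?thesis
    using t(2) by (simp add: numeral_2_eq_2 field_simps)
qed

lemma exp_minus_linear_ge: "z\<^sup>2 / 2 * exp (- \<bar>z\<bar>) \<le> exp z - 1 - z" for z :: real
proof -
  obtain t where t: "\<bar>t\<bar> \<le> \<bar>z\<bar>" "exp z = (\<Sum>m<2. z ^ m / fact m) + exp t / fact 2 * z ^ 2"
    using Maclaurin_exp_le by blast
  have "exp (- \<bar>z\<bar>) * z\<^sup>2 \<le> exp t * z\<^sup>2"
    using t(1) by (intro mult_right_mono) auto
  then show ?thesis
    using t(2) by (simp add: numeral_2_eq_2 field_simps)
qed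

text \<open>On [-1,1] the exponent \<open>z\<close> is bounded by a multiple of \<bar>\<mu>\<bar>,
  so the remainder \<open>exp z - 1 - z\<close> is of order \<open>\<mu>\<^sup>2\<close>; so is the
  part \<open>\<mu>\<^sup>2 / 2\<close> of \<open>z\<close> itself.\<close>

lemma tilt_linear_bound:
  assumes "\<bar>\<mu>\<bar> \<le> b" "\<bar>x\<bar> \<le> 1"
  shows "\<bar>tilt \<mu> x - 1 - \<mu> * x\<bar> \<le> (1 + (1 + b / 2)\<^sup>2 * exp (b + b\<^sup>2 / 2)) * \<mu>\<^sup>2"
proof -
  define z where "z = \<mu> * x - \<mu>\<^sup>2 / 2"
  have \<mu>x: "\<bar>\<mu> * x\<bar> \<le> \<bar>\<mu>\<bar>"
    using assms by (simp add: abs_mult mult_left_le)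
  have \<mu>b: "\<mu>\<^sup>2 \<le> \<bar>\<mu>\<bar> * b"
    using assms by (metis abs_ge_zero mult_left_mono power2_abs power2_eq_square)
  have z1: "\<bar>z\<bar> \<le> \<bar>\<mu>\<bar> * (1 + b / 2)"
    using \<mu>x \<mu>b abs_triangle_ineq4[of "\<mu> * x" "\<mu>\<^sup>2 / 2"]
    unfolding z_def by (simp add: algebra_simps)
  have "\<bar>\<mu>\<bar> * (1 + b / 2) \<le> b * (1 + b / 2)"
    using assms by (intro mult_right_mono) auto
  with z1 have z2: "\<bar>z\<bar> \<le> b + b\<^sup>2 / 2"
    by (simp add: algebra_simps power2_eq_square)
  have z3: "z\<^sup>2 \<le> \<mu>\<^sup>2 * (1 + b / 2)\<^sup>2"
    using power_mono[OF z1, of 2] by (simp add: power_mult_distrib)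
  have lower: "0 \<le> exp z - 1 - z"
    using exp_ge_add_one_self[of z] by linarith
  have "exp z - 1 - z \<le> z\<^sup>2 * exp \<bar>z\<bar>"
  proof -
    have "z\<^sup>2 / 2 * exp \<bar>z\<bar> \<le> z\<^sup>2 * exp \<bar>z\<bar>" by (intro mult_right_mono) auto
    then show ?thesis using exp_minus_linear_le[of z] by linarith
  qed
  also have "\<dots> \<le> (\<mu>\<^sup>2 * (1 + b / 2)\<^sup>2) * exp (b + b\<^sup>2 / 2)"
    using z2 z3 by (intro mult_mono) auto
  finally have "\<bar>exp z - 1 - z\<bar> \<le> (1 + b / 2)\<^sup>2 * exp (b + b\<^sup>2 / 2) * \<mu>\<^sup>2"
    using lower by (simp add: mult_ac)
  moreover have "tilt \<mu> x - 1 - \<mu> * x = (exp z - 1 - z) - \<mu>\<^sup>2 / 2"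
    by (simp add: tilt_def z_def)
  moreover have "(1 + (1 + b / 2)\<^sup>2 * exp (b + b\<^sup>2 / 2)) * \<mu>\<^sup>2
      = \<mu>\<^sup>2 + (1 + b / 2)\<^sup>2 * exp (b + b\<^sup>2 / 2) * \<mu>\<^sup>2"
    by (simp add: distrib_right)
  ultimately show ?thesis
    using zero_le_power2[of \<mu>] by linarith
qed

text \<open>Write \<open>tilt \<mu> x = tilt \<mu> y * exp z\<close> with
  \<open>z = \<mu> * (x - y)\<close>. The modulus combines \<open>exp (- (2 * b))\<close> from the
  Taylor remainder, as \<bar>z\<bar> \<le> 2b, with the lower bound
  \<open>exp (- b - b\<^sup>2 / 2)\<close> for \<open>tilt \<mu> y\<close>.\<close>

lemma tilt_strongly_convex:
  assumes "\<bar>\<mu>\<bar> \<le> b" "\<bar>x\<bar> \<le> 1" "\<bar>y\<bar> \<le> 1"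
  shows "tilt \<mu> y + \<mu> * tilt \<mu> y * (x - y) + exp (- 3 * b - b\<^sup>2 / 2) / 2 * \<mu>\<^sup>2 * (x - y)\<^sup>2 \<le> tilt \<mu> x"
proof -
  define z where "z = \<mu> * (x - y)"
  have "\<bar>z\<bar> \<le> b * 2"
    unfolding z_def abs_mult using assms by (intro mult_mono) auto
  then have "exp (- (2 * b)) \<le> exp (- \<bar>z\<bar>)" by simp
  then have "z\<^sup>2 / 2 * exp (- (2 * b)) \<le> z\<^sup>2 / 2 * exp (- \<bar>z\<bar>)"
    by (intro mult_left_mono) auto
  then have 1: "1 + z + z\<^sup>2 / 2 * exp (- (2 * b)) \<le> exp z"
    using exp_minus_linear_ge[of z] by simp
  have "\<bar>\<mu> * y\<bar> \<le> b * 1"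
    unfolding abs_mult using assms by (intro mult_mono) auto
  moreover have "\<mu>\<^sup>2 \<le> b\<^sup>2"
    using assms(1) power_mono[of "\<bar>\<mu>\<bar>" b 2] by simp
  ultimately have 2: "exp (- b - b\<^sup>2 / 2) \<le> tilt \<mu> y"
    unfolding tilt_def by simp
  have "exp (- 3 * b - b\<^sup>2 / 2) = exp (- b - b\<^sup>2 / 2) * exp (- (2 * b))"
    by (simp flip: exp_add)
  then have "exp (- 3 * b - b\<^sup>2 / 2) / 2 * \<mu>\<^sup>2 * (x - y)\<^sup>2 
      = exp (- b - b\<^sup>2 / 2) * (z\<^sup>2 / 2 * exp (- (2 * b)))"
    by (simp add: z_def power_mult_distrib)
  also have "\<dots> \<le> tilt \<mu> y * (z\<^sup>2 / 2 * exp (- (2 * b)))"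
    using 2 by (intro mult_right_mono) auto
  finally have 3: "exp (- 3 * b - b\<^sup>2 / 2) / 2 * \<mu>\<^sup>2 * (x - y)\<^sup>2 \<le> tilt \<mu> y * (z\<^sup>2 / 2 * exp (- (2 * b)))" .
  have "tilt \<mu> x = tilt \<mu> y * exp z"
    by (simp add: tilt_def z_def algebra_simps flip: exp_add)
  moreover have "tilt \<mu> y * (1 + z + z\<^sup>2 / 2 * exp (- (2 * b))) \<le> tilt \<mu> y * exp z"
    using 1 by (intro mult_left_mono) (auto simp: less_imp_le)
  ultimately show ?thesis
    using 3 by (simp add: algebra_simps z_def)
qed

section \<open>Mixtures of tilts and their separation from one\<close>

definition mix_tilt :: "real \<Rightarrow> real \<Rightarrow> real \<Rightarrow> real \<Rightarrow> real" where
  "mix_tilt \<pi> \<mu>1 \<mu>2 x = \<pi> * tilt \<mu>1 x + (1 - \<pi>) * tilt \<mu>2 x"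

definition mix_mean :: "real \<Rightarrow> real \<Rightarrow> real \<Rightarrow> real" where
  "mix_mean \<pi> \<mu>1 \<mu>2 = \<pi> * \<mu>1 + (1 - \<pi>) * \<mu>2"

definition mix_sq :: "real \<Rightarrow> real \<Rightarrow> real \<Rightarrow> real" where
  "mix_sq \<pi> \<mu>1 \<mu>2 = \<pi> * \<mu>1\<^sup>2 + (1 - \<pi>) * \<mu>2\<^sup>2"

lemma abs_mix_le:
  fixes \<pi> :: real
  assumes "0 \<le> \<pi>" "\<pi> \<le> 1" "\<bar>x\<bar> \<le> C * \<mu>1\<^sup>2" "\<bar>y\<bar> \<le> C * \<mu>2\<^sup>2"
  shows "\<bar>\<pi> * x + (1 - \<pi>) * y\<bar> \<le> C * mix_sq \<pi> \<mu>1 \<mu>2"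
proof -
  have "\<bar>\<pi> * x\<bar> \<le> \<pi> * (C * \<mu>1\<^sup>2)" "\<bar>(1 - \<pi>) * y\<bar> \<le> (1 - \<pi>) * (C * \<mu>2\<^sup>2)"
    unfolding abs_mult using assms by (auto intro!: mult_mono)
  then show ?thesis
    by (simp add: mix_sq_def algebra_simps)
qed

text \<open>All windows lie in [-1,1], where tilts are bounded, and have length 1/2. The outer ones
  stay at distance 1/4 from the middle one, which leaves room for the convexity gain.\<close>

abbreviation windows :: "real set set" where
  "windows \<equiv> {{-1..-1/2}, {-1/4..1/4}, {1/2..1}}"

text \<open>If the mean dominates the second moment, \<open>r - 1\<close> is essentially linear with slope \<open>m\<close>;
  otherwise strong convexity, with modulus of order the second moment, prevents \<open>r - 1\<close> from being
  small at a point of the middle window and also at points of both outer windows.\<close>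
lemma mix_tilt_separated:
  assumes "b > 0"
  obtains K where "K > 0"
    "\<And>\<pi> \<mu>1 \<mu>2. 0 \<le> \<pi> \<Longrightarrow> \<pi> \<le> 1 \<Longrightarrow> \<bar>\<mu>1\<bar> \<le> b \<Longrightarrow> \<bar>\<mu>2\<bar> \<le> b \<Longrightarrow>
      \<exists>J\<in>windows. \<forall>x\<in>J. K * ((mix_mean \<pi> \<mu>1 \<mu>2)\<^sup>2 + (mix_sq \<pi> \<mu>1 \<mu>2)\<^sup>2) \<le> (mix_tilt \<pi> \<mu>1 \<mu>2 x - 1)\<^sup>2"
proof -
  \<comment> \<open>\<open>C\<close> is the constant of \<open>tilt_linear_bound\<close>, and
    \<open>32 * e\<close> is the convexity modulus: over a distance 1/4 it yields
    \<open>2 * e * s\<close>. \<open>Q\<close> comes from \<bar>m\<bar> \<le> 4 C s when the mean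
    does not dominate; the two entries of the minimum serve the two cases.\<close>
  define C where "C = 1 + (1 + b / 2)\<^sup>2 * exp (b + b\<^sup>2 / 2)"
  define e where "e = exp (- 3 * b - b\<^sup>2 / 2) / 64"
  define Q where "Q = 1 + 16 * C\<^sup>2"
  define K where "K = min (1 / 32) (e\<^sup>2 / Q)"
  have C: "C \<ge> 1" and e: "e > 0" by (simp_all add: C_def e_def)
  have Q: "Q > 0" by (simp add: Q_def add_pos_nonneg)
  have K: "K > 0" using e Q by (simp add: K_def)
  have K_le: "K \<le> 1 / 32" "K \<le> e\<^sup>2 / Q"
    unfolding K_def by (rule min.cobounded1, rule min.cobounded2)
  show thesis
  proof (rule that[OF K])
    fix \<pi> \<mu>1 \<mu>2 :: real
    assume \<pi>: "0 \<le> \<pi>" "\<pi> \<le> 1" and \<mu>: "\<bar>\<mu>1\<bar> \<le> b" "\<bar>\<mu>2\<bar> \<le> b"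
    define m s r where "m = mix_mean \<pi> \<mu>1 \<mu>2" and "s = mix_sq \<pi> \<mu>1 \<mu>2" and "r = mix_tilt \<pi> \<mu>1 \<mu>2"
    have s0: "s \<ge> 0" using \<pi> by (simp add: s_def mix_sq_def)
    have lin: "\<bar>r x - 1 - m * x\<bar> \<le> C * s" if "\<bar>x\<bar> \<le> 1" for x
    proof -
      have "r x - 1 - m * x = \<pi> * (tilt \<mu>1 x - 1 - \<mu>1 * x) + (1 - \<pi>) * (tilt \<mu>2 x - 1 - \<mu>2 * x)"
        by (simp add: r_def m_def mix_tilt_def mix_mean_def algebra_simps)
      also have "\<bar>\<dots>\<bar> \<le> C * s"
        unfolding s_def C_def
        by (intro abs_mix_le \<pi> tilt_linear_bound \<mu> that)
      finally show ?thesis .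
    qed
    \<comment> \<open>The derivative of \<open>r\<close> at \<open>y\<close>, so \<open>conv\<close>
      bounds \<open>r\<close> below by its tangent plus a quadratic.\<close>
    define d where "d y = \<pi> * (\<mu>1 * tilt \<mu>1 y) + (1 - \<pi>) * (\<mu>2 * tilt \<mu>2 y)" for y
    have conv: "r y + d y * (x - y) + 32 * e * s * (x - y)\<^sup>2 \<le> r x" if "\<bar>x\<bar> \<le> 1" "\<bar>y\<bar> \<le> 1" for x y
    proof -
      have 32: "32 * e = exp (- 3 * b - b\<^sup>2 / 2) / 2" by (simp add: e_def)
      have h: "tilt \<mu> y + \<mu> * tilt \<mu> y * (x - y) + 32 * e * \<mu>\<^sup>2 * (x - y)\<^sup>2 \<le> tilt \<mu> x"
        if "\<bar>\<mu>\<bar> \<le> b" for \<mu>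
        unfolding 32 by (intro tilt_strongly_convex \<open>\<bar>x\<bar> \<le> 1\<close> \<open>\<bar>y\<bar> \<le> 1\<close> that)
      show ?thesis
        using mult_left_mono[OF h[OF \<mu>(1)] \<pi>(1)] mult_left_mono[OF h[OF \<mu>(2)], of "1 - \<pi>"] \<pi>
        by (simp add: r_def s_def d_def mix_tilt_def mix_sq_def algebra_simps)
    qed
    show "\<exists>J\<in>windows. \<forall>x\<in>J. K * (m\<^sup>2 + s\<^sup>2) \<le> (r x - 1)\<^sup>2"
    proof (cases "4 * C * s \<le> \<bar>m\<bar>")
      case True
      have "\<forall>x\<in>{1/2..1}. K * (m\<^sup>2 + s\<^sup>2) \<le> (r x - 1)\<^sup>2"
      proof
        fix x :: real assume x: "x \<in> {1/2..1}"
        have "\<bar>m\<bar> * (1/2) \<le> \<bar>m\<bar> * x" using x by (intro mult_left_mono) auto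
        then have "\<bar>m\<bar> / 2 \<le> \<bar>m * x\<bar>" using x by (simp add: abs_mult)
        moreover have "\<bar>r x - 1 - m * x\<bar> \<le> C * s" using lin[of x] x by simp
        moreover have "4 * (C * s) \<le> \<bar>m\<bar>" using True by simp
        ultimately have "\<bar>m\<bar> / 4 \<le> \<bar>r x - 1\<bar>" by linarith
        then have *: "(\<bar>m\<bar> / 4)\<^sup>2 \<le> (r x - 1)\<^sup>2" using power_mono[of "\<bar>m\<bar>/4" "\<bar>r x - 1\<bar>" 2] by simp
        have "1 * s \<le> 4 * C * s" using C s0 by (intro mult_right_mono) auto
        then have "s \<le> \<bar>m\<bar>" using True by simp
        then have "s\<^sup>2 \<le> m\<^sup>2" using s0 power_mono[of s "\<bar>m\<bar>" 2] by simp
        then have "K * (m\<^sup>2 + s\<^sup>2) \<le> 1 / 32 * (m\<^sup>2 + m\<^sup>2)"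
          by (intro mult_mono add_left_mono) (use K_le(1) in simp_all)
        also have "\<dots> \<le> (\<bar>m\<bar> / 4)\<^sup>2" by (simp add: power_divide)
        finally show "K * (m\<^sup>2 + s\<^sup>2) \<le> (r x - 1)\<^sup>2" using * by simp
      qed
      then show ?thesis by (rule bexI[where x = "{1/2..1}"]) simp
    next
      case False
      then have "\<bar>m\<bar> \<le> 4 * C * s" by simp
      then have "m\<^sup>2 \<le> 16 * C\<^sup>2 * s\<^sup>2" using power_mono[of "\<bar>m\<bar>" "4 * C * s" 2]
        by (simp add: power_mult_distrib)
      then have "m\<^sup>2 + s\<^sup>2 \<le> Q * s\<^sup>2" by (simp add: Q_def algebra_simps)
      then have "K * (m\<^sup>2 + s\<^sup>2) \<le> e\<^sup>2 / Q * (Q * s\<^sup>2)"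
        using K_le Q by (intro mult_mono) simp_all
      also have "\<dots> = (e * s)\<^sup>2"
        using Q by (simp add: power_mult_distrib)
      finally have Kle: "K * (m\<^sup>2 + s\<^sup>2) \<le> (e * s)\<^sup>2" .
      have sq: "K * (m\<^sup>2 + s\<^sup>2) \<le> (r x - 1)\<^sup>2" if "e * s \<le> \<bar>r x - 1\<bar>" for x
        using Kle power_mono[OF that, of 2] e s0 by simp
      show ?thesis
      proof (cases "\<forall>y\<in>{-1/4..1/4}. e * s \<le> \<bar>r y - 1\<bar>")
        case True
        then have "\<forall>x\<in>{-1/4..1/4}. K * (m\<^sup>2 + s\<^sup>2) \<le> (r x - 1)\<^sup>2" using sq by blast
        then show ?thesis by (rule bexI[where x = "{-1/4..1/4}"]) simp
      next
        case False
        then obtain y where y: "-1/4 \<le> y" "y \<le> 1/4" "\<bar>r y - 1\<bar> < e * s" by auto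
        \<comment> \<open>On the side of \<open>y\<close> where the tangent does not fall,
          \<open>r\<close> exceeds \<open>r y\<close> by at least \<open>2 * (e * s)\<close>, while
          \<open>r y\<close> is within \<open>e * s\<close> of 1. The sign of \<open>d y\<close>
          then picks the outer window.\<close>
        have far: "e * s \<le> \<bar>r x - 1\<bar>" if "\<bar>x\<bar> \<le> 1" "1/4 \<le> \<bar>x - y\<bar>" "0 \<le> d y * (x - y)" for x
        proof -
          have "(1/4)\<^sup>2 \<le> (x - y)\<^sup>2" using that(2) power_mono[of "1/4" "\<bar>x - y\<bar>" 2] by simp
          then have "32 * e * s * (1/4)\<^sup>2 \<le> 32 * e * s * (x - y)\<^sup>2"
            using e s0 by (intro mult_left_mono) auto
          then have "2 * (e * s) \<le> 32 * e * s * (x - y)\<^sup>2" by (simp add: power2_eq_square)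
          moreover have "r y + d y * (x - y) + 32 * e * s * (x - y)\<^sup>2 \<le> r x"
            using conv[of x y] that(1) y by simp
          ultimately show ?thesis using that(3) y(3) by linarith
        qed
        show ?thesis
        proof (cases "0 \<le> d y")
          case True
          have "\<forall>x\<in>{1/2..1}. K * (m\<^sup>2 + s\<^sup>2) \<le> (r x - 1)\<^sup>2"
          proof
            fix x :: real assume "x \<in> {1/2..1}"
            then show "K * (m\<^sup>2 + s\<^sup>2) \<le> (r x - 1)\<^sup>2"
              using True y by (intro sq far mult_nonneg_nonneg) auto
          qed
          then show ?thesis by (rule bexI[where x = "{1/2..1}"]) simp
        next
          case False
          have "\<forall>x\<in>{-1..-1/2}. K * (m\<^sup>2 + s\<^sup>2) \<le> (r x - 1)\<^sup>2"
          proof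
            fix x :: real assume "x \<in> {-1..-1/2}"
            then show "K * (m\<^sup>2 + s\<^sup>2) \<le> (r x - 1)\<^sup>2"
              using False y by (intro sq far mult_nonpos_nonpos) auto
          qed
          then show ?thesis by (rule bexI[where x = "{-1..-1/2}"]) simp
        qed
      qed
    qed
  qed
qed

section \<open>Uniform bound on the log-likelihood ratio\<close>

lemma cosh_minus_one_le: "cosh y - 1 \<le> y\<^sup>2 * exp \<bar>y\<bar>" for y :: real
proof -
  have "cosh y - 1 \<le> y\<^sup>2 / 2 * exp \<bar>y\<bar>"
  proof -
    have "cosh y = (exp y + exp (- y)) / 2" by (simp add: cosh_def)
    moreover have "exp (- y) - 1 + y \<le> y\<^sup>2 / 2 * exp \<bar>y\<bar>" using exp_minus_linear_le[of "- y"] by simp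
    ultimately show ?thesis using exp_minus_linear_le[of y] by (simp add: field_simps)
  qed
  also have "\<dots> \<le> y\<^sup>2 * exp \<bar>y\<bar>" by (intro mult_right_mono) auto
  finally show ?thesis .
qed

lemma linear_minus_quadratic_le:
  fixes y a c :: real
  assumes "a > 0"
  shows "c * y \<le> a * y\<^sup>2 + c\<^sup>2 / (4 * a)"
proof -
  have "0 \<le> a * (y - c / (2 * a))\<^sup>2" using assms by simp
  also have "\<dots> = a * y\<^sup>2 - c * y + c\<^sup>2 / (4 * a)"
    using assms by (simp add: power2_eq_square field_simps)
  finally show ?thesis by simp
qed

lemma mix_tilt_pos:
  assumes "0 \<le> \<pi>" "\<pi> \<le> 1"
  shows "0 < mix_tilt \<pi> \<mu>1 \<mu>2 x"
proof (cases "\<pi> = 0")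
  case False
  then have "0 < \<pi> * tilt \<mu>1 x" using assms by simp
  moreover have "0 \<le> (1 - \<pi>) * tilt \<mu>2 x" using assms by (simp add: less_imp_le)
  ultimately show ?thesis by (simp add: mix_tilt_def)
qed (simp add: mix_tilt_def)

lemma mix_tilt_le:
  assumes "0 \<le> \<pi>" "\<pi> \<le> 1" "\<bar>\<mu>1\<bar> \<le> b" "\<bar>\<mu>2\<bar> \<le> b" "\<bar>x\<bar> \<le> 1"
  shows "mix_tilt \<pi> \<mu>1 \<mu>2 x \<le> exp b"
proof -
  have *: "tilt \<mu> x \<le> exp b" if "\<bar>\<mu>\<bar> \<le> b" for \<mu>
  proof -
    have "\<bar>\<mu> * x\<bar> \<le> b * 1"
      unfolding abs_mult using assms that by (intro mult_mono) auto
    then have "\<mu> * x - \<mu>\<^sup>2 / 2 \<le> b" using zero_le_power2[of \<mu>] by linarith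
    then show ?thesis by (simp add: tilt_def)
  qed
  have "mix_tilt \<pi> \<mu>1 \<mu>2 x \<le> \<pi> * exp b + (1 - \<pi>) * exp b"
    unfolding mix_tilt_def using assms * by (intro add_mono mult_left_mono) auto
  then show ?thesis by (simp add: algebra_simps)
qed

text \<open>\<open>exp (\<mu>\<^sup>2 / 2) * cosh (\<mu> * t)\<close> is the moment generating
  function of the mixture centred at -t and t. Multiplying by
  \<open>E = exp (- \<mu>\<^sup>2 / 2)\<close> leaves \<open>n * cosh (\<mu> * t)\<close>, above n
  by order \<open>n * \<mu>\<^sup>2 * t\<^sup>2\<close> only. The error \<open>d\<close> and the
  replacement of \<open>E * Z\<close> by \<open>Z\<close> cost order
  \<open>\<mu>\<^sup>2 * V\<close>.\<close>

lemma sum_tilt_centred_bound: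
  fixes xs :: "nat \<Rightarrow> real"
  assumes t: "0 \<le> t" "t \<le> b" and \<mu>: "\<bar>\<mu>\<bar> \<le> b" and Z: "\<bar>Z\<bar> \<le> V"
    and dev: "\<bar>(\<Sum>i=1..n. exp (\<mu> * xs i)) - real n * (exp (\<mu>\<^sup>2 / 2) * cosh (\<mu> * t)) - \<mu> * Z\<bar> \<le> \<mu>\<^sup>2 * V"
  shows "\<bar>(\<Sum>i=1..n. tilt \<mu> (xs i)) - real n - \<mu> * Z\<bar>
    \<le> (exp (b\<^sup>2) * (real n * t\<^sup>2) + (1 + b / 2) * V) * \<mu>\<^sup>2"
proof -
  define d where "d = (\<Sum>i=1..n. exp (\<mu> * xs i)) - real n * (exp (\<mu>\<^sup>2 / 2) * cosh (\<mu> * t)) - \<mu> * Z"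
  define E where "E = exp (- \<mu>\<^sup>2 / 2)"
  have E: "0 \<le> E" "E \<le> 1" "1 - E \<le> \<mu>\<^sup>2 / 2" and EE: "E * exp (\<mu>\<^sup>2 / 2) = 1"
    using exp_ge_add_one_self[of "- \<mu>\<^sup>2 / 2"] by (simp_all add: E_def flip: exp_add)
  have "(\<Sum>i=1..n. tilt \<mu> (xs i)) = E * (\<Sum>i=1..n. exp (\<mu> * xs i))"
    by (simp add: tilt_def E_def sum_distrib_left flip: exp_add)
  also have "\<dots> = E * d + real n * (E * exp (\<mu>\<^sup>2 / 2)) * cosh (\<mu> * t) + E * (\<mu> * Z)"
    by (simp add: d_def algebra_simps)
  finally have eq: "(\<Sum>i=1..n. tilt \<mu> (xs i)) - real n - \<mu> * Z
      = real n * (cosh (\<mu> * t) - 1) + E * d - (1 - E) * (\<mu> * Z)"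
    by (simp add: EE algebra_simps)
  have "\<bar>\<mu> * t\<bar> \<le> b * b"
    unfolding abs_mult using t \<mu> by (intro mult_mono) auto
  then have "(\<mu> * t)\<^sup>2 * exp \<bar>\<mu> * t\<bar> \<le> (\<mu> * t)\<^sup>2 * exp (b\<^sup>2)"
    by (intro mult_left_mono) (auto simp: power2_eq_square)
  then have "cosh (\<mu> * t) - 1 \<le> exp (b\<^sup>2) * t\<^sup>2 * \<mu>\<^sup>2"
    using cosh_minus_one_le[of "\<mu> * t"] by (simp add: power_mult_distrib mult_ac)
  then have "real n * (cosh (\<mu> * t) - 1) \<le> real n * (exp (b\<^sup>2) * t\<^sup>2 * \<mu>\<^sup>2)"
    by (intro mult_left_mono) auto
  moreover have "0 \<le> real n * (cosh (\<mu> * t) - 1)"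
    using cosh_real_ge_1[of "\<mu> * t"] by (intro mult_nonneg_nonneg) auto
  moreover have "\<bar>E * d\<bar> \<le> 1 * (\<mu>\<^sup>2 * V)"
    unfolding abs_mult using E dev by (intro mult_mono) (auto simp: d_def)
  moreover have "\<bar>(1 - E) * (\<mu> * Z)\<bar> \<le> \<mu>\<^sup>2 / 2 * (b * V)"
    unfolding abs_mult using E \<mu> Z by (intro mult_mono) auto
  moreover have "(exp (b\<^sup>2) * (real n * t\<^sup>2) + (1 + b / 2) * V) * \<mu>\<^sup>2
      = real n * (exp (b\<^sup>2) * t\<^sup>2 * \<mu>\<^sup>2) + 1 * (\<mu>\<^sup>2 * V) + \<mu>\<^sup>2 / 2 * (b * V)"
    by (simp add: algebra_simps)
  ultimately show ?thesis unfolding eq by linarith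
qed

text \<open>\<open>Z\<close> plays the role of the sum of the centred observations. Likelihood ratios against the standard
  normal density are mixtures of exponentials, so controlling the exponential sums up to second
  order in \<open>\<mu>\<close> controls the log-likelihood uniformly over the mixture model.\<close>
definition deviation_control ::
  "real \<Rightarrow> real \<Rightarrow> real \<Rightarrow> real \<Rightarrow> nat \<Rightarrow> (nat \<Rightarrow> real) \<Rightarrow> bool" where
  "deviation_control b t q L n x \<longleftrightarrow>
    (\<exists>Z V. \<bar>Z\<bar> \<le> V \<and> V \<le> L * sqrt (real n) \<and>
      (\<forall>J\<in>windows. q * real n \<le> (\<Sum>i=1..n. indicator J (x i))) \<and>
      (\<forall>\<mu>. \<bar>\<mu>\<bar> \<le> b \<longrightarrow>
        \<bar>(\<Sum>i=1..n. exp (\<mu> * x i)) - real n * (exp (\<mu>\<^sup>2 / 2) * cosh (\<mu> * t)) - \<mu> * Z\<bar> \<le> \<mu>\<^sup>2 * V))"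

text \<open>The fluctuation \<open>m * Z + Y * s\<close> is linear in the parameters
  \<open>m\<close> and \<open>s\<close>, whereas the gain collected on one window is of order
  \<open>n * (m\<^sup>2 + s\<^sup>2)\<close>. Their balance is at most of order
  \<open>(Z\<^sup>2 + Y\<^sup>2) / n\<close>, free of the mixture parameters.\<close>

lemma log_likelihood_ratio_bound:
  assumes b: "b > 0" and q: "q > 0"
  obtains A where "A > 0"
    "\<And>t n xs L \<pi> \<mu>1 \<mu>2. \<lbrakk>0 \<le> t; t \<le> b; n \<ge> 1; 0 \<le> \<pi>; \<pi> \<le> 1; \<bar>\<mu>1\<bar> \<le> b; \<bar>\<mu>2\<bar> \<le> b;
       deviation_control b t q L n xs\<rbrakk> \<Longrightarrow>
       (\<Sum>i=1..n. ln (mix_tilt \<pi> \<mu>1 \<mu>2 (xs i))) \<le> A * (real n * t ^ 4 + L\<^sup>2)"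
proof -
  obtain K where K: "K > 0" and sep: "\<And>\<pi> \<mu>1 \<mu>2. 0 \<le> \<pi> \<Longrightarrow> \<pi> \<le> 1 \<Longrightarrow> \<bar>\<mu>1\<bar> \<le> b \<Longrightarrow> \<bar>\<mu>2\<bar> \<le> b \<Longrightarrow>
      \<exists>J\<in>windows. \<forall>x\<in>J. K * ((mix_mean \<pi> \<mu>1 \<mu>2)\<^sup>2 + (mix_sq \<pi> \<mu>1 \<mu>2)\<^sup>2) \<le> (mix_tilt \<pi> \<mu>1 \<mu>2 x - 1)\<^sup>2"
    using mix_tilt_separated[OF b] by blast
  \<comment> \<open>\<open>k\<close> comes from \<open>ln_le_quadratic\<close> with
    \<open>R = exp b\<close>, the bound for mixtures on [-1,1]; \<kappa> is the gain per
    observation; \<open>C1\<close> and \<open>C2\<close> are the constants of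
    \<open>sum_tilt_centred_bound\<close>.\<close>
  define k where "k = 1 / (2 * exp b)"
  define \<kappa> where "\<kappa> = k * K * q"
  define C1 where "C1 = exp (b\<^sup>2)"
  define C2 where "C2 = 1 + b / 2"
  define c where "c = 1 + 2 * C2\<^sup>2 + 2 * C1\<^sup>2"
  define A where "A = c / (4 * \<kappa>)"
  have k: "k > 0" by (simp add: k_def)
  have \<kappa>: "\<kappa> > 0" using k K q by (simp add: \<kappa>_def)
  have A: "A > 0" unfolding A_def c_def using \<kappa> by (intro divide_pos_pos add_pos_nonneg) auto
  show thesis
  proof (rule that[OF A])
    fix t L \<pi> \<mu>1 \<mu>2 :: real and n :: nat and xs :: "nat \<Rightarrow> real"
    assume t: "0 \<le> t" "t \<le> b" and n: "n \<ge> 1" and \<pi>: "0 \<le> \<pi>" "\<pi> \<le> 1" and \<mu>: "\<bar>\<mu>1\<bar> \<le> b" "\<bar>\<mu>2\<bar> \<le> b"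
      and control: "deviation_control b t q L n xs"
    from control[unfolded deviation_control_def] obtain Z V where Z: "\<bar>Z\<bar> \<le> V"
      and V: "V \<le> L * sqrt (real n)"
      and count: "\<And>J. J \<in> windows \<Longrightarrow> q * real n \<le> (\<Sum>i=1..n. indicator J (xs i))"
      and dev: "\<And>\<mu>. \<bar>\<mu>\<bar> \<le> b \<Longrightarrow>
        \<bar>(\<Sum>i=1..n. exp (\<mu> * xs i)) - real n * (exp (\<mu>\<^sup>2 / 2) * cosh (\<mu> * t)) - \<mu> * Z\<bar> \<le> \<mu>\<^sup>2 * V"
      by blast
    define m s r where "m = mix_mean \<pi> \<mu>1 \<mu>2" and "s = mix_sq \<pi> \<mu>1 \<mu>2" and "r = mix_tilt \<pi> \<mu>1 \<mu>2"
    obtain J where J: "J \<in> windows" and KJ: "\<And>x. x \<in> J \<Longrightarrow> K * (m\<^sup>2 + s\<^sup>2) \<le> (r x - 1)\<^sup>2"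
      unfolding m_def s_def r_def using sep[OF \<pi> \<mu>] by blast
    have J1: "\<bar>x\<bar> \<le> 1" if "x \<in> J" for x using J that by auto
    \<comment> \<open>The window \<open>J\<close> depends on the mixture parameters. The gain is
      claimed on \<open>J\<close> only; elsewhere \<open>ln r \<le> r - 1\<close> suffices.\<close>
    have ln_le: "ln (r x) \<le> (r x - 1) - k * K * (m\<^sup>2 + s\<^sup>2) * indicator J x" for x
    proof (cases "x \<in> J")
      case True
      have "ln (r x) \<le> (r x - 1) - (r x - 1)\<^sup>2 / (2 * exp b)"
        using mix_tilt_pos[OF \<pi>] mix_tilt_le[OF \<pi> \<mu> J1[OF True]] b
        by (intro ln_le_quadratic) (auto simp: r_def)
      also have "(r x - 1)\<^sup>2 / (2 * exp b) = k * (r x - 1)\<^sup>2" by (simp add: k_def)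
      finally have "ln (r x) \<le> (r x - 1) - k * (r x - 1)\<^sup>2" .
      moreover have "k * (K * (m\<^sup>2 + s\<^sup>2)) \<le> k * (r x - 1)\<^sup>2"
        using KJ[OF True] k by (intro mult_left_mono) auto
      ultimately show ?thesis using True by simp
    next
      case False
      then show ?thesis using ln_le_minus_one[of "r x"] mix_tilt_pos[OF \<pi>] by (simp add: r_def)
    qed
    have "(\<Sum>i=1..n. ln (r (xs i))) \<le> (\<Sum>i=1..n. (r (xs i) - 1) - k * K * (m\<^sup>2 + s\<^sup>2) * indicator J (xs i))"
      by (intro sum_mono ln_le)
    also have "\<dots> = (\<Sum>i=1..n. r (xs i) - 1) - k * K * (m\<^sup>2 + s\<^sup>2) * (\<Sum>i=1..n. indicator J (xs i))"
      by (simp add: sum_subtractf sum_distrib_left)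
    finally have 1: "(\<Sum>i=1..n. ln (r (xs i)))
        \<le> (\<Sum>i=1..n. r (xs i) - 1) - k * K * (m\<^sup>2 + s\<^sup>2) * (\<Sum>i=1..n. indicator J (xs i))" .
    have 2: "k * K * (m\<^sup>2 + s\<^sup>2) * (q * real n) \<le> k * K * (m\<^sup>2 + s\<^sup>2) * (\<Sum>i=1..n. indicator J (xs i))"
      using count[OF J] k K by (intro mult_left_mono) auto
    define Y where "Y = C1 * (real n * t\<^sup>2) + C2 * V"
    have "(\<Sum>i=1..n. r (xs i) - 1) - m * Z
        = \<pi> * ((\<Sum>i=1..n. tilt \<mu>1 (xs i)) - real n - \<mu>1 * Z)
          + (1 - \<pi>) * ((\<Sum>i=1..n. tilt \<mu>2 (xs i)) - real n - \<mu>2 * Z)"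
      by (simp add: r_def m_def mix_tilt_def mix_mean_def sum_subtractf sum.distrib
          sum_distrib_left algebra_simps)
    also have "\<bar>\<dots>\<bar> \<le> Y * s"
      unfolding s_def Y_def C1_def C2_def by (intro abs_mix_le \<pi> sum_tilt_centred_bound t \<mu> Z dev)
    finally have 3: "(\<Sum>i=1..n. r (xs i) - 1) \<le> m * Z + Y * s" by linarith
    have \<kappa>n: "\<kappa> * real n > 0" using \<kappa> n by simp
    \<comment> \<open>Squares are completed separately in \<open>m\<close> and \<open>s\<close>:
      each linear term is absorbed by its own part of the gain.\<close>
    have "m * Z \<le> \<kappa> * real n * m\<^sup>2 + Z\<^sup>2 / (4 * (\<kappa> * real n))"
      using linear_minus_quadratic_le[OF \<kappa>n, of Z m] by (simp add: mult_ac)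
    moreover have "Z\<^sup>2 \<le> V\<^sup>2" using Z power_mono[of "\<bar>Z\<bar>" V 2] by simp
    then have "Z\<^sup>2 / (4 * (\<kappa> * real n)) \<le> V\<^sup>2 / (4 * (\<kappa> * real n))"
      using \<kappa>n by (intro divide_right_mono) auto
    moreover have "Y * s \<le> \<kappa> * real n * s\<^sup>2 + Y\<^sup>2 / (4 * (\<kappa> * real n))"
      using linear_minus_quadratic_le[OF \<kappa>n] .
    moreover have "Y\<^sup>2 \<le> 2 * (C1 * (real n * t\<^sup>2))\<^sup>2 + 2 * (C2 * V)\<^sup>2"
      unfolding Y_def using sum_squares_bound[of "C1 * (real n * t\<^sup>2)" "C2 * V"] by (simp add: power2_sum)
    then have "Y\<^sup>2 / (4 * (\<kappa> * real n)) \<le> (2 * (C1 * (real n * t\<^sup>2))\<^sup>2 + 2 * (C2 * V)\<^sup>2) / (4 * (\<kappa> * real n))"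
      using \<kappa>n by (intro divide_right_mono) auto
    ultimately have "(\<Sum>i=1..n. ln (r (xs i))) \<le> V\<^sup>2 / (4 * (\<kappa> * real n))
        + (2 * (C1 * (real n * t\<^sup>2))\<^sup>2 + 2 * (C2 * V)\<^sup>2) / (4 * (\<kappa> * real n))"
      using 1 2 3 by (simp add: \<kappa>_def algebra_simps)
    also have "\<dots> = (2 * C1\<^sup>2 * (real n * t ^ 4) + (1 + 2 * C2\<^sup>2) * (V\<^sup>2 / real n)) / (4 * \<kappa>)"
      using n \<kappa> by (simp add: field_simps power2_eq_square eval_nat_numeral)
    also have "\<dots> \<le> A * (real n * t ^ 4 + V\<^sup>2 / real n)"
    proof -
      have "2 * C1\<^sup>2 * (real n * t ^ 4) + (1 + 2 * C2\<^sup>2) * (V\<^sup>2 / real n)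
          \<le> c * (real n * t ^ 4) + c * (V\<^sup>2 / real n)"
        by (rule add_mono; rule mult_right_mono) (auto simp: c_def)
      then have "(2 * C1\<^sup>2 * (real n * t ^ 4) + (1 + 2 * C2\<^sup>2) * (V\<^sup>2 / real n)) / (4 * \<kappa>)
          \<le> (c * (real n * t ^ 4)
            + c * (V\<^sup>2 / real n)) / (4 * \<kappa>)"
        by (rule divide_right_mono) (use \<kappa> in simp)
      also have "\<dots> = A * (real n * t ^ 4 + V\<^sup>2 / real n)"
        by (simp only: A_def times_divide_eq_left distrib_left add_divide_distrib)
      finally show ?thesis .
    qed
    also have "\<dots> \<le> A * (real n * t ^ 4 + L\<^sup>2)"
    proof -
      have "V\<^sup>2 \<le> (L * sqrt (real n))\<^sup>2" using Z V by (intro power_mono) auto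
      then have "V\<^sup>2 / real n \<le> L\<^sup>2" using n by (simp add: power_mult_distrib divide_le_eq)
      then show ?thesis using A by (intro mult_left_mono) auto
    qed
    finally show "(\<Sum>i=1..n. ln (mix_tilt \<pi> \<mu>1 \<mu>2 (xs i))) \<le> A * (real n * t ^ 4 + L\<^sup>2)"
      unfolding r_def .
  qed
qed

section \<open>Deviations of empirical moments\<close>

text \<open>Centred independent summands are uncorrelated, so the second moment of the sum is at
  most \<open>a\<^sup>2\<close> with \<open>a = s * sqrt (card I)\<close>. Integrating \<bar>y\<bar>
  \<le> (y^2 / a + a) / 2 turns this into a bound on the mean absolute value.\<close>

lemma iid_sum_deviation:
  fixes M :: "'a measure" and g :: "'a \<Rightarrow> real" and I :: "'i set"
  assumes M: "prob_space M" and I: "finite I"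
    and g [measurable]: "g \<in> borel_measurable M" and g2: "integrable M (\<lambda>x. (g x)\<^sup>2)"
    and s: "s > 0" "(\<integral>x. (g x)\<^sup>2 \<partial>M) \<le> s\<^sup>2"
  shows "(\<integral>\<^sup>+x. ennreal \<bar>\<Sum>i\<in>I. g (x i) - (\<integral>y. g y \<partial>M)\<bar> \<partial>(\<Pi>\<^sub>M i\<in>I. M))
    \<le> ennreal (s * sqrt (real (card I)))"
\<comment> \<open>The empty sum is split off because \<open>a\<close> has to be positive.\<close>
proof (cases "I = {}")
  case False
  interpret prob_space M by fact
  interpret P: product_prob_space "\<lambda>_. M" I by standard
  define h where "h y = g y - (\<integral>y. g y \<partial>M)" for y
  have [measurable]: "h \<in> borel_measurable M" unfolding h_def by measurable
  have g1: "integrable M g" by (rule square_integrable_imp_integrable[OF g g2])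
  have h1: "integrable M h" "(\<integral>y. h y \<partial>M) = 0"
    using g1 by (simp_all add: h_def[abs_def] prob_space)
  have h2: "integrable M (\<lambda>y. (h y)\<^sup>2)"
    using g1 g2 by (simp add: h_def power2_diff)
  have h2_le: "(\<integral>y. (h y)\<^sup>2 \<partial>M) \<le> s\<^sup>2"
    unfolding h_def variance_eq[OF g1 g2] using s(2) zero_le_power2[of "\<integral>y. g y \<partial>M"] by linarith
  have cross: "integrable (\<Pi>\<^sub>M i\<in>I. M) (\<lambda>x. h (x i) * h (x j))
      \<and> (\<integral>x. h (x i) * h (x j) \<partial>(\<Pi>\<^sub>M i\<in>I. M)) = (if i = j then (\<integral>y. (h y)\<^sup>2 \<partial>M) else 0)"
    if "i \<in> I" "j \<in> I" for i j
  proof -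
    \<comment> \<open>Chosen so that the product of \<open>f k (x k)\<close> over \<open>I\<close>
      is \<open>h (x i) * h (x j)\<close>, also for \<open>i = j\<close>; the integral then
      factorises, with a factor 0 whenever i and j differ.\<close>
    define f where "f k = (if k = i \<and> k = j then (\<lambda>y. (h y)\<^sup>2) else if k = i \<or> k = j then h else (\<lambda>_. 1))" for k
    have f: "integrable M (f k)" for k using h1 h2 by (simp add: f_def)
    have eq: "(\<Prod>k\<in>I. f k (x k)) = h (x i) * h (x j)" for x
    proof -
      have "(\<Prod>k\<in>I. f k (x k)) = (\<Prod>k\<in>{i, j}. f k (x k))"
        using I that by (intro prod.mono_neutral_right) (auto simp: f_def)
      then show ?thesis by (cases "i = j") (auto simp: f_def power2_eq_square)
    qed
    have "(\<Prod>k\<in>I. \<integral>y. f k y \<partial>M) = (\<Prod>k\<in>{i, j}. \<integral>y. f k y \<partial>M)"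
      using I that by (intro prod.mono_neutral_right) (auto simp: f_def prob_space)
    also have "\<dots> = (if i = j then (\<integral>y. (h y)\<^sup>2 \<partial>M) else 0)"
      using h1 by (auto simp: f_def)
    finally show ?thesis
      using P.product_integrable_prod[of I f, OF I f] P.product_integral_prod[of I f, OF I f] by (simp add: eq)
  qed
  define S where "S x = (\<Sum>i\<in>I. h (x i))" for x :: "'i \<Rightarrow> 'a"
  have S2: "(S x)\<^sup>2 = (\<Sum>i\<in>I. \<Sum>j\<in>I. h (x i) * h (x j))" for x
    by (simp add: S_def power2_eq_square sum_product)
  have intS2: "integrable (\<Pi>\<^sub>M i\<in>I. M) (\<lambda>x. (S x)\<^sup>2)"
    unfolding S2 using cross by (intro Bochner_Integration.integrable_sum) auto
  have "(\<integral>x. (S x)\<^sup>2 \<partial>(\<Pi>\<^sub>M i\<in>I. M)) = (\<Sum>i\<in>I. \<integral>x. (\<Sum>j\<in>I. h (x i) * h (x j)) \<partial>(\<Pi>\<^sub>M i\<in>I. M))"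
    unfolding S2 using cross
    by (intro Bochner_Integration.integral_sum Bochner_Integration.integrable_sum) auto
  also have "\<dots> = (\<Sum>i\<in>I. \<Sum>j\<in>I. \<integral>x. h (x i) * h (x j) \<partial>(\<Pi>\<^sub>M i\<in>I. M))"
    using cross by (intro sum.cong refl Bochner_Integration.integral_sum) auto
  also have "\<dots> = (\<Sum>i\<in>I. \<Sum>j\<in>I. if i = j then (\<integral>y. (h y)\<^sup>2 \<partial>M) else 0)"
    using cross by (intro sum.cong refl) auto
  also have "\<dots> = real (card I) * (\<integral>y. (h y)\<^sup>2 \<partial>M)"
    using I by simp
  also have "\<dots> \<le> real (card I) * s\<^sup>2"
    using h2_le by (intro mult_left_mono) auto
  finally have ES2: "(\<integral>x. (S x)\<^sup>2 \<partial>(\<Pi>\<^sub>M i\<in>I. M)) \<le> real (card I) * s\<^sup>2" .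
  define a where "a = s * sqrt (real (card I))"
  have a: "a > 0" using s I False by (simp add: a_def card_gt_0_iff)
  have a2: "a\<^sup>2 = real (card I) * s\<^sup>2" by (simp add: a_def power_mult_distrib)
  have amgm: "\<bar>y\<bar> \<le> (y\<^sup>2 / a + a) / 2" for y :: real
    using sum_squares_bound[of "\<bar>y\<bar>" a] a by (simp add: field_simps power2_eq_square)
  have "(\<integral>\<^sup>+x. ennreal \<bar>S x\<bar> \<partial>(\<Pi>\<^sub>M i\<in>I. M)) \<le> (\<integral>\<^sup>+x. ennreal (((S x)\<^sup>2 / a + a) / 2) \<partial>(\<Pi>\<^sub>M i\<in>I. M))"
    by (intro nn_integral_mono ennreal_leI amgm)
  also have "\<dots> = ennreal (\<integral>x. ((S x)\<^sup>2 / a + a) / 2 \<partial>(\<Pi>\<^sub>M i\<in>I. M))"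
    using intS2 a by (intro nn_integral_eq_integral) auto
  also have "\<dots> \<le> ennreal a"
  proof (rule ennreal_leI)
    have "(\<integral>x. ((S x)\<^sup>2 / a + a) / 2 \<partial>(\<Pi>\<^sub>M i\<in>I. M)) = ((\<integral>x. (S x)\<^sup>2 \<partial>(\<Pi>\<^sub>M i\<in>I. M)) / a + a) / 2"
      using intS2 P.P.prob_space by simp
    also have "\<dots> \<le> (a\<^sup>2 / a + a) / 2"
      using ES2 a by (intro divide_right_mono add_right_mono) (auto simp: a2)
    also have "\<dots> = a" using a by (simp add: power2_eq_square)
    finally show "(\<integral>x. ((S x)\<^sup>2 / a + a) / 2 \<partial>(\<Pi>\<^sub>M i\<in>I. M)) \<le> a" .
  qed
  finally show ?thesis
    by (simp add: S_def h_def a_def)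
qed simp

section \<open>Moments and exponential moments\<close>

lemma power_le_fact_exp: "0 \<le> y \<Longrightarrow> y ^ k \<le> fact k * exp y" for y :: real
proof -
  assume y: "0 \<le> y"
  have "(\<Sum>i\<in>{k}. y ^ i /\<^sub>R fact i) \<le> exp y"
    unfolding exp_def using y summable_exp_generic[of y] by (intro sum_le_suminf) auto
  then show ?thesis by (simp add: field_simps)
qed

lemma exp_abs_le: "exp \<bar>y\<bar> \<le> exp y + exp (- y)" for y :: real
  by (cases "y \<ge> 0") (auto simp: add_increasing)

text \<open>Both parts rest on \<bar>y\<bar> entering through \<open>exp y + exp (- y)\<close>: this
  dominates the powers up to a factorial, and it dominates all absolute partial sums of the
  exponential series, so that series and integral may be exchanged.\<close>

lemma moment_sums:
  fixes M :: "real measure"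
  assumes sets: "sets M = sets borel" and mgf: "\<And>a. integrable M (\<lambda>x. exp (a * x))"
  shows "integrable M (\<lambda>x. x ^ k)"
    and "(\<lambda>k. \<mu> ^ k / fact k * (\<integral>x. x ^ k \<partial>M)) sums (\<integral>x. exp (\<mu> * x) \<partial>M)"
proof -
  note [measurable_cong] = sets
  have "integrable M (\<lambda>x. fact k * (exp (1 * x) + exp (- 1 * x)))" for k
    by (intro integrable_mult_right Bochner_Integration.integrable_add mgf)
  then have int: "integrable M (\<lambda>x. x ^ k)" for k
  proof (rule Bochner_Integration.integrable_bound)
    have "\<bar>x\<bar> ^ k \<le> fact k * (exp x + exp (- x))" for x :: real
      using order.trans[OF power_le_fact_exp[of "\<bar>x\<bar>" k] mult_left_mono[OF exp_abs_le[of x]]] by simp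
    then show "AE x in M. norm (x ^ k) \<le> norm (fact k * (exp (1 * x) + exp (- 1 * x)))"
      by (auto simp: power_abs abs_mult)
  qed measurable
  then show "integrable M (\<lambda>x. x ^ k)" .
  have intE: "integrable M (\<lambda>x. exp (\<mu> * x) + exp (- \<mu> * x))"
    by (intro Bochner_Integration.integrable_add mgf)
  have exp_sums: "(\<lambda>k. \<bar>\<mu> ^ k / fact k * x ^ k\<bar>) sums exp \<bar>\<mu> * x\<bar>" for x
    using exp_converges[of "\<bar>\<mu> * x\<bar>"]
    by (simp add: power_abs abs_mult power_mult_distrib divide_inverse mult_ac)
  have "(\<lambda>k. \<integral>x. \<mu> ^ k / fact k * x ^ k \<partial>M) sums (\<integral>x. (\<Sum>k. \<mu> ^ k / fact k * x ^ k) \<partial>M)"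
  proof (rule sums_integral)
    show "integrable M (\<lambda>x. \<mu> ^ k / fact k * x ^ k)" for k
      using int[of k] by simp
    show "AE x in M. summable (\<lambda>k. norm (\<mu> ^ k / fact k * x ^ k))"
      using exp_sums by (auto simp: sums_iff)
    show "summable (\<lambda>k. \<integral>x. norm (\<mu> ^ k / fact k * x ^ k) \<partial>M)"
    proof (rule summableI_nonneg_bounded)
      fix N
      have "(\<Sum>k<N. \<integral>x. norm (\<mu> ^ k / fact k * x ^ k) \<partial>M) = (\<integral>x. (\<Sum>k<N. norm (\<mu> ^ k / fact k * x ^ k)) \<partial>M)"
        using int by (intro Bochner_Integration.integral_sum[symmetric] integrable_norm integrable_mult_right)
      also have "\<dots> \<le> (\<integral>x. exp (\<mu> * x) + exp (- \<mu> * x) \<partial>M)"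
      proof (rule integral_mono[OF _ intE])
        show "integrable M (\<lambda>x. \<Sum>k<N. norm (\<mu> ^ k / fact k * x ^ k))"
          using int by (intro Bochner_Integration.integrable_sum integrable_norm integrable_mult_right)
        fix x :: real
        have "(\<Sum>k<N. norm (\<mu> ^ k / fact k * x ^ k)) \<le> exp \<bar>\<mu> * x\<bar>"
          using exp_sums[of x] sum_le_suminf[of "\<lambda>k. \<bar>\<mu> ^ k / fact k * x ^ k\<bar>" "{..<N}"]
          by (auto simp: sums_iff)
        also have "\<dots> \<le> exp (\<mu> * x) + exp (- \<mu> * x)" using exp_abs_le[of "\<mu> * x"] by simp
        finally show "(\<Sum>k<N. norm (\<mu> ^ k / fact k * x ^ k)) \<le> exp (\<mu> * x) + exp (- \<mu> * x)" .
      qed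
      finally show "(\<Sum>k<N. \<integral>x. norm (\<mu> ^ k / fact k * x ^ k) \<partial>M) \<le> (\<integral>x. exp (\<mu> * x) + exp (- \<mu> * x) \<partial>M)" .
    qed auto
  qed
  moreover have "(\<Sum>k. \<mu> ^ k / fact k * x ^ k) = exp (\<mu> * x)" for x
    using exp_converges[of "\<mu> * x"] by (simp add: sums_iff power_mult_distrib divide_inverse mult_ac)
  ultimately show "(\<lambda>k. \<mu> ^ k / fact k * (\<integral>x. x ^ k \<partial>M)) sums (\<integral>x. exp (\<mu> * x) \<partial>M)"
    by simp
qed

section \<open>The symmetric mixture and its moments\<close>

lemma normal_density_mgf:
  "has_bochner_integral lborel (\<lambda>x. normal_density \<mu> 1 x * exp (a * x)) (exp (a * \<mu> + a\<^sup>2 / 2))"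
proof -
  have "normal_density \<mu> 1 x * exp (a * x) = exp (a * \<mu> + a\<^sup>2 / 2) * normal_density (\<mu> + a) 1 x" for x
  proof -
    have "- (x - \<mu>)\<^sup>2 / 2 + a * x = (a * \<mu> + a\<^sup>2 / 2) + - (x - (\<mu> + a))\<^sup>2 / 2"
      by (simp add: power2_eq_square field_simps)
    then show ?thesis
      by (simp add: normal_density_def flip: exp_add)
  qed
  then show ?thesis by (simp add: has_bochner_integral_iff)
qed

text \<open>The weight is written \<open>1 - 1 / 2\<close> to match the shape of the members of
  \<open>M2\<close> literally.\<close>

definition sym_mix :: "real \<Rightarrow> real \<Rightarrow> real" where
  "sym_mix t x = 1 / 2 * normal_density (- t) 1 x + (1 - 1 / 2) * normal_density t 1 x"

abbreviation sym_law :: "real \<Rightarrow> real measure" where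
  "sym_law t \<equiv> density lborel (\<lambda>x. ennreal (sym_mix t x))"

lemma sym_mix_nonneg [simp]: "0 \<le> sym_mix t x"
  by (simp add: sym_mix_def)

lemma sym_mix_measurable [measurable]: "sym_mix t \<in> borel_measurable borel"
  unfolding sym_mix_def[abs_def] by measurable

lemma sym_mix_mgf:
  "has_bochner_integral lborel (\<lambda>x. sym_mix t x * exp (a * x)) (exp (a\<^sup>2 / 2) * cosh (a * t))"
proof -
  have "has_bochner_integral lborel
      (\<lambda>x. 1 / 2 * (normal_density (- t) 1 x * exp (a * x)) + (1 - 1 / 2) * (normal_density t 1 x * exp (a * x)))
      (1 / 2 * exp (a * - t + a\<^sup>2 / 2) + (1 - 1 / 2) * exp (a * t + a\<^sup>2 / 2))"
    by (intro has_bochner_integral_add has_bochner_integral_mult_right normal_density_mgf)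
  moreover have "1 / 2 * exp (a * - t + a\<^sup>2 / 2) + (1 - 1 / 2) * exp (a * t + a\<^sup>2 / 2)
      = exp (a\<^sup>2 / 2) * cosh (a * t)"
  proof -
    have "exp (a * - t + a\<^sup>2 / 2) = exp (- (a * t)) * exp (a\<^sup>2 / 2)"
      and "exp (a * t + a\<^sup>2 / 2) = exp (a * t) * exp (a\<^sup>2 / 2)"
      by (simp_all flip: exp_add)
    then show ?thesis by (simp add: cosh_def algebra_simps)
  qed
  ultimately show ?thesis
    by (simp add: sym_mix_def algebra_simps)
qed

lemma sym_law_mgf:
  "has_bochner_integral (sym_law t) (\<lambda>x. exp (a * x)) (exp (a\<^sup>2 / 2) * cosh (a * t))"
  by (intro has_bochner_integral_density) (simp_all add: sym_mix_mgf)

lemma prob_space_sym_law: "prob_space (sym_law t)"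
proof -
  have "has_bochner_integral lborel (sym_mix t) 1"
    using sym_mix_mgf[of t 0] by simp
  then have "(\<integral>\<^sup>+x. ennreal (sym_mix t x) \<partial>lborel) = 1"
    by (subst nn_integral_eq_integral) (auto simp: has_bochner_integral_iff)
  then show ?thesis
    by (intro prob_spaceI) (simp add: emeasure_density)
qed

text \<open>The bound \<open>4 ^ k\<close> on the central binomial coefficient, cleared of
  denominators.\<close>

lemma fact_double_le: "(fact (2 * k) :: real) \<le> 4 ^ k * (fact k)\<^sup>2"
proof (induction k)
  case (Suc k)
  have "(fact (2 * Suc k) :: real) = (2 * real k + 2) * (2 * real k + 1) * fact (2 * k)"
    by (simp add: algebra_simps)
  also have "\<dots> \<le> (2 * real k + 2) * (2 * real k + 2) * (4 ^ k * (fact k)\<^sup>2)"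
    by (intro mult_mono Suc.IH) auto
  also have "\<dots> = 4 ^ Suc k * (fact (Suc k))\<^sup>2"
    by (simp add: power2_eq_square algebra_simps)
  finally show ?case .
qed simp

text \<open>The exponential moment at \<open>4 * b\<close> makes the scaled standard deviations of the powers
  decay geometrically.\<close>
lemma sym_law_even_moment:
  assumes b: "b > 0" and t: "0 \<le> t" "t \<le> b"
  shows "(\<integral>x. (x ^ k)\<^sup>2 \<partial>sym_law t) \<le> ((fact k / b ^ k) * (exp (6 * b\<^sup>2) * 2) * (1 / 2) ^ k)\<^sup>2"
proof -
  \<comment> \<open>With \<open>a = 4 * b\<close>, the factor
    \<open>fact (2 * k) / a ^ (2 * k)\<close> is at most
    \<open>(fact k / b ^ k)\<^sup>2 * (1 / 4) ^ k\<close>, whose root carries the geometric factor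
    \<open>(1 / 2) ^ k\<close>.\<close>
  define a where "a = 4 * b"
  have a: "a > 0" using b by (simp add: a_def)
  note mgf = sym_law_mgf[of t, unfolded has_bochner_integral_iff]
  have mgf': "integrable (sym_law t) (\<lambda>x. exp (- a * x))"
    "(\<integral>x. exp (- a * x) \<partial>sym_law t) = exp (a\<^sup>2 / 2) * cosh (a * t)"
    using mgf[of "- a"] by simp_all
  have int: "integrable (sym_law t) (\<lambda>x. (x ^ k)\<^sup>2)"
    using moment_sums(1)[of "sym_law t" "k * 2"] mgf by (simp add: power_mult)
  have "(\<integral>x. (x ^ k)\<^sup>2 \<partial>sym_law t) \<le> (\<integral>x. fact (2 * k) / a ^ (2 * k) * (exp (a * x) + exp (- a * x)) \<partial>sym_law t)"
  proof (rule integral_mono[OF int])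
    show "integrable (sym_law t) (\<lambda>x. fact (2 * k) / a ^ (2 * k) * (exp (a * x) + exp (- a * x)))"
      using mgf[of a] mgf' by (intro integrable_mult_right Bochner_Integration.integrable_add) auto
    fix x :: real
    have "(a * x) ^ (2 * k) = \<bar>a * x\<bar> ^ (2 * k)" by (simp add: power_mult)
    also have "\<dots> \<le> fact (2 * k) * exp \<bar>a * x\<bar>" by (intro power_le_fact_exp) simp
    also have "\<dots> \<le> fact (2 * k) * (exp (a * x) + exp (- a * x))"
      using exp_abs_le[of "a * x"] by (intro mult_left_mono) auto
    finally show "(x ^ k)\<^sup>2 \<le> fact (2 * k) / a ^ (2 * k) * (exp (a * x) + exp (- a * x))"
      using a by (simp add: power_mult_distrib power_mult field_simps flip: power_mult)
  qed
  also have "\<dots> = fact (2 * k) / a ^ (2 * k) * (2 * exp (a\<^sup>2 / 2) * cosh (a * t))"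
    using mgf[of a] mgf' by simp
  also have "\<dots> \<le> (4 ^ k * (fact k)\<^sup>2) / a ^ (2 * k) * (4 * (exp (6 * b\<^sup>2))\<^sup>2)"
  proof -
    \<comment> \<open>\<open>exp (a\<^sup>2 / 2)\<close> is \<open>exp (8 * b\<^sup>2)\<close> and
      the hyperbolic cosine adds at most \<open>exp (4 * b\<^sup>2)\<close>; the factor 2 is
      enlarged to 4 to keep a perfect square.\<close>
    have "cosh (a * t) \<le> exp (a * t)" using a t by (simp add: cosh_def)
    also have "\<dots> \<le> exp (4 * b\<^sup>2)"
      using a b t by (simp add: a_def power2_eq_square)
    finally have "2 * exp (a\<^sup>2 / 2) * cosh (a * t) \<le> 2 * exp (a\<^sup>2 / 2) * exp (4 * b\<^sup>2)"
      by (intro mult_left_mono) auto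
    also have "\<dots> = 2 * (exp (6 * b\<^sup>2))\<^sup>2"
      by (simp add: a_def power_mult_distrib power2_eq_square flip: exp_add)
    also have "\<dots> \<le> 4 * (exp (6 * b\<^sup>2))\<^sup>2" by simp
    finally have *: "2 * exp (a\<^sup>2 / 2) * cosh (a * t) \<le> 4 * (exp (6 * b\<^sup>2))\<^sup>2" .
    show ?thesis
      by (rule mult_mono[OF divide_right_mono[OF fact_double_le] *]) (use a in auto)
  qed
  also have "\<dots> = ((fact k / b ^ k) * (exp (6 * b\<^sup>2) * 2) * (1 / 2) ^ k)\<^sup>2"
  proof -
    define d \<beta> where "d = (2::real) ^ k" and "\<beta> = b ^ k"
    have d: "d > 0" "\<beta> > 0" using b by (simp_all add: d_def \<beta>_def)
    have 4: "(4::real) ^ k = d\<^sup>2" by (simp add: d_def power2_eq_square flip: power_mult_distrib)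
    have a2k: "a ^ (2 * k) = (d\<^sup>2 * \<beta>)\<^sup>2"
      by (simp only: a_def \<beta>_def mult.commute[of 2 k] power_mult power_mult_distrib 4)
    have half: "(1 / 2) ^ k = 1 / d" by (simp add: d_def power_one_over)
    have "d\<^sup>2 * F\<^sup>2 / (d\<^sup>2 * \<beta>)\<^sup>2 * (4 * H\<^sup>2) = (F / \<beta> * (H * 2) * (1 / d))\<^sup>2" for F H :: real
      using d by (simp add: power2_eq_square mult_ac)
    then show ?thesis unfolding 4 a2k half \<beta>_def[symmetric] .
  qed
  finally show ?thesis .
qed

text \<open>After the terms of order 0 and 1 are removed, \<open>\<mu>\<^sup>2\<close> factors out
  of the tail, and the remaining powers of \<bar>\<mu>\<bar> are bounded by powers of
  \<open>b\<close>. One series at radius \<open>b\<close> thus controls all \<mu> at once.\<close>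

lemma power_series_deviation:
  fixes S :: "nat \<Rightarrow> real"
  assumes b: "b > 0" and \<mu>: "\<bar>\<mu>\<bar> \<le> b" and S0: "S 0 = 0"
    and sm: "summable (\<lambda>k. b ^ k / fact k * \<bar>S k\<bar>)"
    and D: "(\<lambda>k. \<mu> ^ k / fact k * S k) sums D"
  shows "\<bar>D - \<mu> * S 1\<bar> \<le> \<mu>\<^sup>2 * ((\<Sum>k. b ^ k / fact k * \<bar>S k\<bar>) / b\<^sup>2)"
proof -
  define g where "g k = b ^ k / fact k * \<bar>S k\<bar>" for k
  have g0: "0 \<le> g k" for k using b by (simp add: g_def)
  have sg: "summable g" using sm by (simp add: g_def[abs_def])
  have shift: "(\<lambda>k. \<mu> ^ (k + 2) / fact (k + 2) * S (k + 2)) sums (D - \<mu> * S 1)"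
    using sums_split_initial_segment[OF D, of 2] by (simp add: numeral_2_eq_2 S0)
  have sg2: "summable (\<lambda>k. g (k + 2))" using sg by (rule summable_ignore_initial_segment)
  have le: "\<bar>\<mu> ^ (k + 2) / fact (k + 2) * S (k + 2)\<bar> \<le> \<mu>\<^sup>2 / b\<^sup>2 * g (k + 2)" for k
  proof -
    have "\<bar>\<mu>\<bar> ^ k \<le> b ^ k" using \<mu> by (intro power_mono) auto
    then have "\<mu>\<^sup>2 * \<bar>\<mu>\<bar> ^ k * \<bar>S (k + 2)\<bar> \<le> \<mu>\<^sup>2 * b ^ k * \<bar>S (k + 2)\<bar>"
      by (intro mult_right_mono mult_left_mono) auto
    then have "\<mu>\<^sup>2 * \<bar>\<mu>\<bar> ^ k * \<bar>S (k + 2)\<bar> / fact (k + 2) \<le> \<mu>\<^sup>2 * b ^ k * \<bar>S (k + 2)\<bar> / fact (k + 2)"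
      by (rule divide_right_mono) simp
    moreover have "\<bar>\<mu> ^ (k + 2) / fact (k + 2) * S (k + 2)\<bar> = \<mu>\<^sup>2 * \<bar>\<mu>\<bar> ^ k * \<bar>S (k + 2)\<bar> / fact (k + 2)"
    proof -
      have "\<bar>fact (k + 2) :: real\<bar> = fact (k + 2)" by (rule abs_of_pos) (rule fact_gt_zero)
      then show ?thesis
        by (simp only: abs_mult abs_divide power_abs power_add power2_abs) (simp only: times_divide_eq_left times_divide_eq_right mult_ac)
    qed
    moreover have "\<mu>\<^sup>2 / b\<^sup>2 * g (k + 2) = \<mu>\<^sup>2 * b ^ k * \<bar>S (k + 2)\<bar> / fact (k + 2)"
      using b by (simp only: g_def power_add) (simp add: mult_ac)
    ultimately show ?thesis by simp
  qed
  have "norm (D - \<mu> * S 1) \<le> (\<Sum>k. \<mu>\<^sup>2 / b\<^sup>2 * g (k + 2))"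
    using shift le sg2 by (subst sums_unique[OF shift], intro norm_suminf_le) (auto intro: summable_mult)
  also have "\<dots> = \<mu>\<^sup>2 / b\<^sup>2 * (\<Sum>k. g (k + 2))"
    using sg2 by (rule suminf_mult)
  also have "\<dots> \<le> \<mu>\<^sup>2 / b\<^sup>2 * (\<Sum>k. g k)"
    using suminf_split_initial_segment[OF sg, of 2] g0
    by (intro mult_left_mono) (auto simp: sum_nonneg)
  finally show ?thesis by (simp add: g_def)
qed

text \<open>The density is at least \<open>c\<close> on [-1,1], uniformly in
  \<open>t \<le> b\<close>, and every window has length 1/2.\<close>

lemma sym_law_window_ge:
  assumes t: "0 \<le> t" "t \<le> b" and J: "J \<in> windows"
  shows "exp (- (1 + b)\<^sup>2 / 2) / sqrt (2 * pi) / 2 \<le> measure (sym_law t) J"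
proof -
  interpret prob_space "sym_law t" by (rule prob_space_sym_law)
  define c where "c = exp (- (1 + b)\<^sup>2 / 2) / sqrt (2 * pi)"
  have c: "c \<ge> 0" by (simp add: c_def)
  have *: "c \<le> normal_density \<mu> 1 x" if "\<bar>\<mu>\<bar> \<le> b" "\<bar>x\<bar> \<le> 1" for \<mu> x
  proof -
    have "\<bar>x - \<mu>\<bar> \<le> 1 + b" using that by linarith
    then have "(x - \<mu>)\<^sup>2 \<le> (1 + b)\<^sup>2" using power_mono[of "\<bar>x - \<mu>\<bar>" "1 + b" 2] by simp
    then show ?thesis by (simp add: c_def normal_density_def divide_right_mono)
  qed
  have ge: "c \<le> sym_mix t x" if "x \<in> J" for x
  proof -
    have x: "\<bar>x\<bar> \<le> 1" using J that by auto
    show ?thesis using *[of t x] *[of "- t" x] x t by (simp add: sym_mix_def)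
  qed
  have [measurable]: "J \<in> sets borel" using J by auto
  have "emeasure lborel J = ennreal (1 / 2)" using J by auto
  then have "(\<integral>\<^sup>+x. ennreal c * indicator J x \<partial>lborel) = ennreal c * ennreal (1 / 2)"
    by (subst nn_integral_cmult_indicator) auto
  then have "ennreal (c / 2) = (\<integral>\<^sup>+x. ennreal c * indicator J x \<partial>lborel)"
    using c ennreal_mult[of c "1 / 2"] by simp
  also have "\<dots> \<le> (\<integral>\<^sup>+x. ennreal (sym_mix t x) * indicator J x \<partial>lborel)"
    using ge by (intro nn_integral_mono) (auto simp: indicator_def intro: ennreal_leI)
  also have "\<dots> = emeasure (sym_law t) J"
    by (simp add: emeasure_density)
  finally show ?thesis by (simp add: emeasure_eq_measure c_def)
qed

text \<open>One random variable \<open>T\<close> adds up the weighted deviations of all moments and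
  of the three window counts. Its mean is at most \<open>B * sqrt n\<close>, so by Markov's
  inequality it stays below twice this bound with probability at least 1/2.\<close>

lemma deviation_event:
  assumes b: "b > 0"
  obtains q N L where "q > 0"
    "\<And>t n. \<lbrakk>0 \<le> t; t \<le> b; n \<ge> N; n \<ge> 1\<rbrakk> \<Longrightarrow>
      \<exists>G\<in>sets (sample_law (sym_mix t) n). 1 / 2 \<le> measure (sample_law (sym_mix t) n) G \<and>
        (\<forall>x\<in>G. deviation_control b t q L n x)"
proof -
  \<comment> \<open>\<open>q0\<close> is the lower bound on window probabilities. In
    \<open>B\<close>, the term \<open>2 * G0\<close> sums the geometric series of moment bounds and
    3 counts the windows. \<open>L\<close> is twice \<open>B\<close> times the factor that turns the
    series into both bounds required of \<open>V\<close>.\<close>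
  define q0 where "q0 = exp (- (1 + b)\<^sup>2 / 2) / sqrt (2 * pi) / 2"
  define G0 where "G0 = exp (6 * b\<^sup>2) * 2"
  define B where "B = 2 * G0 + 3"
  define N where "N = nat \<lceil>(4 * B / q0)\<^sup>2\<rceil>"
  define L where "L = 2 * B * (1 / b + 1 / b\<^sup>2)"
  have q0: "q0 > 0" by (simp add: q0_def)
  have G0: "G0 > 0" by (simp add: G0_def)
  then have B: "B > 0" by (simp add: B_def)
  show thesis
  proof (rule that[of "q0 / 2" N L])
    show "q0 / 2 > 0" using q0 by simp
    fix t :: real and n :: nat
    assume t: "0 \<le> t" "t \<le> b" and n: "n \<ge> N" "n \<ge> 1"
    define M where "M = sym_law t"
    define P where "P = (\<Pi>\<^sub>M i\<in>{1..n}. M)"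
    have P_eq: "sample_law (sym_mix t) n = P" by (simp add: sample_law_def P_def M_def)
    interpret M: prob_space M unfolding M_def by (rule prob_space_sym_law)
    interpret prod: product_prob_space "\<lambda>_. M" "{1..n}" by standard
    interpret P: prob_space P unfolding P_def by (rule prod.P.prob_space_axioms)
    have sets_M [measurable_cong]: "sets M = sets borel" by (simp add: M_def)
    have mgf: "integrable M (\<lambda>x. exp (a * x))"
        "(\<integral>x. exp (a * x) \<partial>M) = exp (a\<^sup>2 / 2) * cosh (a * t)" for a
      using sym_law_mgf[of t a] by (simp_all add: M_def has_bochner_integral_iff)
    define S where "S k x = (\<Sum>i=1..n. x i ^ k - (\<integral>y. y ^ k \<partial>M))" for k and x :: "nat \<Rightarrow> real"
    have [measurable]: "S k \<in> borel_measurable P" for k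
      unfolding S_def[abs_def] P_def by measurable
    have ES: "(\<integral>\<^sup>+x. ennreal \<bar>S k x\<bar> \<partial>P) \<le> ennreal ((fact k / b ^ k) * G0 * (1 / 2) ^ k * sqrt (real n))" for k
    proof -
      have "(\<integral>\<^sup>+x. ennreal \<bar>S k x\<bar> \<partial>P)
          \<le> ennreal ((fact k / b ^ k) * G0 * (1 / 2) ^ k * sqrt (real (card {1..n})))"
        unfolding S_def P_def
      proof (rule iid_sum_deviation)
        show "integrable M (\<lambda>x. (x ^ k)\<^sup>2)"
          using moment_sums(1)[OF sets_M mgf(1), of "k * 2"] by (simp add: power_mult)
        show "(\<integral>x. (x ^ k)\<^sup>2 \<partial>M) \<le> (fact k / b ^ k * G0 * (1 / 2) ^ k)\<^sup>2"
          unfolding M_def G0_def by (rule sym_law_even_moment[OF b t])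
      qed (use b G0 M.prob_space_axioms in auto)
      then show ?thesis by simp
    qed
    \<comment> \<open>Extended nonnegative values allow summation and integration to be exchanged
      before convergence is known; finiteness on \<open>G\<close> later gives summability.\<close>
    define W where "W x = (\<Sum>k. ennreal (b ^ k / fact k * \<bar>S k x\<bar>))" for x
    have [measurable]: "W \<in> borel_measurable P"
      unfolding W_def[abs_def] by measurable
    have "(\<integral>\<^sup>+x. W x \<partial>P) = (\<Sum>k. \<integral>\<^sup>+x. ennreal (b ^ k / fact k * \<bar>S k x\<bar>) \<partial>P)"
      unfolding W_def by (intro nn_integral_suminf) measurable
    \<comment> \<open>The weight \<open>b ^ k / fact k\<close> cancels the growth of the moment
      bound in \<open>ES\<close> and leaves a geometric series.\<close>
    also have "\<dots> \<le> (\<Sum>k. ennreal (G0 * sqrt (real n) * (1 / 2) ^ k))"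
    proof (intro suminf_le allI summableI)
      fix k
      have "(\<integral>\<^sup>+x. ennreal (b ^ k / fact k * \<bar>S k x\<bar>) \<partial>P) = ennreal (b ^ k / fact k) * (\<integral>\<^sup>+x. ennreal \<bar>S k x\<bar> \<partial>P)"
        using b by (subst nn_integral_cmult[symmetric]) (auto simp flip: ennreal_mult)
      also have "\<dots> \<le> ennreal (b ^ k / fact k) * ennreal ((fact k / b ^ k) * G0 * (1 / 2) ^ k * sqrt (real n))"
        by (intro mult_left_mono ES) auto
      also have "\<dots> = ennreal (b ^ k / fact k * ((fact k / b ^ k) * G0 * (1 / 2) ^ k * sqrt (real n)))"
        using b G0 by (intro ennreal_mult[symmetric]) auto
      also have "b ^ k / fact k * ((fact k / b ^ k) * G0 * (1 / 2) ^ k * sqrt (real n)) = G0 * sqrt (real n) * (1 / 2) ^ k"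
        using b by simp
      finally show "(\<integral>\<^sup>+x. ennreal (b ^ k / fact k * \<bar>S k x\<bar>) \<partial>P) \<le> ennreal (G0 * sqrt (real n) * (1 / 2) ^ k)" .
    qed
    also have "\<dots> = ennreal (G0 * sqrt (real n) * 2)"
    proof (rule suminf_ennreal_eq)
      show "(\<lambda>k. G0 * sqrt (real n) * (1 / 2) ^ k) sums (G0 * sqrt (real n) * 2)"
        using sums_mult[OF geometric_sums[of "1 / 2 :: real"], of "G0 * sqrt (real n)"] by simp
    qed (use G0 in auto)
    finally have EW: "(\<integral>\<^sup>+x. W x \<partial>P) \<le> ennreal (G0 * sqrt (real n) * 2)" .
    define C where "C J x = \<bar>\<Sum>i=1..n. indicator J (x i) - measure M J\<bar>" for J and x :: "nat \<Rightarrow> real"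
    have J_meas: "J \<in> sets M" if "J \<in> windows" for J using that by (auto simp: sets_M)
    have C_meas: "C J \<in> borel_measurable P" if "J \<in> windows" for J
      using J_meas[OF that, measurable] unfolding C_def[abs_def] P_def by measurable
    have EC: "(\<integral>\<^sup>+x. ennreal (C J x) \<partial>P) \<le> ennreal (sqrt (real n))" if "J \<in> windows" for J
    proof -
      note [measurable] = J_meas[OF that]
      \<comment> \<open>Indicators are their own squares, so the second moment is a probability and
        the scale 1 serves.\<close>
      have sq: "(\<lambda>x. (indicator J x)\<^sup>2) = (indicator J :: real \<Rightarrow> real)"
        by (auto simp: indicator_def)
      have "(\<integral>\<^sup>+x. ennreal \<bar>\<Sum>i\<in>{1..n}. indicator J (x i) - (\<integral>y. indicator J y \<partial>M)\<bar> \<partial>(\<Pi>\<^sub>M i\<in>{1..n}. M))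
          \<le> ennreal (1 * sqrt (real (card {1..n})))"
        by (intro iid_sum_deviation M.prob_space_axioms)
           (use M.prob_le_1 in \<open>auto simp: sq less_top[symmetric]\<close>)
      then show ?thesis by (simp add: C_def P_def)
    qed
    define T where "T x = W x + (\<Sum>J\<in>windows. ennreal (C J x))" for x
    note [measurable] = C_meas
    have T_meas [measurable]: "T \<in> borel_measurable P"
      unfolding T_def[abs_def] by (intro borel_measurable_add borel_measurable_sum) auto
    have "(\<integral>\<^sup>+x. T x \<partial>P) = (\<integral>\<^sup>+x. W x \<partial>P) + (\<Sum>J\<in>windows. \<integral>\<^sup>+x. ennreal (C J x) \<partial>P)"
      unfolding T_def by (subst nn_integral_add, measurable, subst nn_integral_sum) auto
    also have "\<dots> \<le> ennreal (G0 * sqrt (real n) * 2) + (\<Sum>J\<in>windows. ennreal (sqrt (real n)))"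
      by (intro add_mono EW sum_mono EC)
    also have "\<dots> \<le> ennreal (G0 * sqrt (real n) * 2) + ennreal (3 * sqrt (real n))"
    proof (rule add_left_mono)
      have "card windows \<le> 3" by (intro card_insert_le_m1) auto
      then have "real (card windows) * sqrt (real n) \<le> 3 * sqrt (real n)"
        by (intro mult_right_mono) auto
      then show "(\<Sum>J\<in>windows. ennreal (sqrt (real n))) \<le> ennreal (3 * sqrt (real n))"
        by (simp add: ennreal_mult)
    qed
    also have "\<dots> = ennreal (B * sqrt (real n))"
      using G0 by (simp add: B_def algebra_simps flip: ennreal_plus)
    finally have ET: "(\<integral>\<^sup>+x. T x \<partial>P) \<le> ennreal (B * sqrt (real n))" .
    \<comment> \<open>Twice the bound on the mean of \<open>T\<close>, which makes the Markov bound
      1/2.\<close>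
    define U where "U = 2 * B * sqrt (real n)"
    have U: "U > 0" using B n by (simp add: U_def)
    define G where "G = {x \<in> space P. T x < ennreal U}"
    have G_sets: "G \<in> sets P" unfolding G_def by measurable
    have "emeasure P {x \<in> space P. 1 \<le> ennreal (1 / U) * T x} \<le> ennreal (1 / U) * (\<integral>\<^sup>+x. T x * indicator (space P) x \<partial>P)"
      by (rule nn_integral_Markov_inequality) auto
    also have "(\<integral>\<^sup>+x. T x * indicator (space P) x \<partial>P) = (\<integral>\<^sup>+x. T x \<partial>P)"
      by (intro nn_integral_cong) auto
    also have "ennreal (1 / U) * (\<integral>\<^sup>+x. T x \<partial>P) \<le> ennreal (1 / U) * ennreal (B * sqrt (real n))"
      using ET by (intro mult_left_mono) auto
    also have "\<dots> = ennreal (1 / 2)"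
      using U B n by (simp add: U_def flip: ennreal_mult)
    finally have "ennreal (measure P {x \<in> space P. 1 \<le> ennreal (1 / U) * T x}) \<le> ennreal (1 / 2)"
      by (simp only: P.emeasure_eq_measure)
    then have "measure P {x \<in> space P. 1 \<le> ennreal (1 / U) * T x} \<le> 1 / 2"
      by (subst (asm) ennreal_le_iff) auto
    moreover have "space P - G = {x \<in> space P. 1 \<le> ennreal (1 / U) * T x}"
    proof -
      \<comment> \<open>The scaled event in Markov's inequality is the complement of
        \<open>G\<close>, also where \<open>T\<close> is infinite.\<close>
      have "(T x < ennreal U) \<longleftrightarrow> \<not> 1 \<le> ennreal (1 / U) * T x" for x
      proof (cases "T x")
        case (real r)
        then show ?thesis using U
          by (simp add: ennreal_less_iff not_le field_simps flip: ennreal_mult ennreal_1)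
      next
        case top
        then show ?thesis using U by (simp add: ennreal_mult_top)
      qed
      then show ?thesis by (auto simp: G_def)
    qed
    ultimately have G_prob: "1 / 2 \<le> measure P G"
      using P.prob_compl[OF G_sets] by simp
    have G_good: "deviation_control b t (q0 / 2) L n x" if x: "x \<in> G" for x
    proof -
      have "W x \<le> T x" by (simp add: T_def)
      also have T: "T x < ennreal U" using x by (simp add: G_def)
      finally have W: "W x < ennreal U" .
      define g where "g k = b ^ k / fact k * \<bar>S k x\<bar>" for k
      have g0: "0 \<le> g k" for k using b by (simp add: g_def)
      have sg: "summable g"
        using W g0 unfolding W_def by (intro summable_suminf_not_top) (auto simp: g_def)
      define w where "w = (\<Sum>k. g k)"
      have w0: "0 \<le> w" unfolding w_def using g0 sg by (intro suminf_nonneg)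
      have "W x = ennreal w"
        unfolding W_def w_def g_def[symmetric] using g0 sg by (intro suminf_ennreal2) auto
      then have w: "w \<le> U" using W w0 by (simp add: ennreal_less_iff less_imp_le)
      have "g 1 \<le> w"
        unfolding w_def using sum_le_suminf[OF sg, of "{1}"] g0 by simp
      then have S1: "\<bar>S 1 x\<bar> \<le> w / b" using b by (simp add: g_def field_simps)
      \<comment> \<open>\<open>V\<close> has to dominate \<open>w / b\<close>, which bounds the
        first-moment deviation, and \<open>w / b\<^sup>2\<close>, which bounds the tail from order
        two on.\<close>
      define V where "V = w * (1 / b + 1 / b\<^sup>2)"
      have "V \<le> U * (1 / b + 1 / b\<^sup>2)"
        unfolding V_def using w b by (intro mult_right_mono) auto
      then have V: "V \<le> L * sqrt (real n)" by (simp add: U_def L_def mult_ac)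
      have V1: "w / b \<le> V" "w / b\<^sup>2 \<le> V" using w0 b by (simp_all add: V_def algebra_simps)
      have count: "q0 / 2 * real n \<le> (\<Sum>i=1..n. indicator J (x i))" if J: "J \<in> windows" for J
      proof -
        have "ennreal (C J x) \<le> (\<Sum>J\<in>windows. ennreal (C J x))"
          using J by (intro member_le_sum) auto
        also have "\<dots> \<le> T x" by (simp add: T_def)
        also note T
        finally have "C J x < U" by (simp add: ennreal_less_iff C_def)
        then have "real n * measure M J - U \<le> (\<Sum>i=1..n. indicator J (x i))"
          by (simp add: C_def sum_subtractf abs_less_iff)
        moreover have "real n * q0 \<le> real n * measure M J"
          using sym_law_window_ge[OF t J] by (intro mult_left_mono) (auto simp: M_def q0_def)
        moreover have "U \<le> q0 / 2 * real n"
        \<comment> \<open>\<open>N\<close> is chosen for this: \<open>U\<close> grows like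
          \<open>sqrt n\<close>, hence costs at most half of the expected count
          \<open>n * q0\<close>.\<close>
        proof -
          have "(4 * B / q0)\<^sup>2 \<le> real n" using n(1) unfolding N_def by linarith
          then have "4 * B / q0 \<le> sqrt (real n)" by (rule real_le_rsqrt)
          then have "4 * B / q0 * sqrt (real n) \<le> sqrt (real n) * sqrt (real n)"
            by (intro mult_right_mono) auto
          then show ?thesis using q0 by (simp add: U_def field_simps)
        qed
        ultimately show ?thesis by (simp add: field_simps)
      qed
      have dev: "\<bar>(\<Sum>i=1..n. exp (\<mu> * x i)) - real n * (exp (\<mu>\<^sup>2 / 2) * cosh (\<mu> * t)) - \<mu> * S 1 x\<bar> \<le> \<mu>\<^sup>2 * V"
        if \<mu>: "\<bar>\<mu>\<bar> \<le> b" for \<mu>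
      proof -
        have exp: "(\<lambda>k. \<mu> ^ k / fact k * y ^ k) sums exp (\<mu> * y)" for y
          using exp_converges[of "\<mu> * y"] by (simp add: power_mult_distrib divide_inverse mult_ac)
        have "(\<lambda>k. \<Sum>i=1..n. (\<mu> ^ k / fact k * x i ^ k - \<mu> ^ k / fact k * (\<integral>y. y ^ k \<partial>M)))
            sums (\<Sum>i=1..n. exp (\<mu> * x i) - (\<integral>y. exp (\<mu> * y) \<partial>M))"
          by (intro sums_sum sums_diff exp moment_sums(2) sets_M mgf(1))
        moreover have "\<mu> ^ k / fact k * S k x
            = (\<Sum>i=1..n. (\<mu> ^ k / fact k * x i ^ k - \<mu> ^ k / fact k * (\<integral>y. y ^ k \<partial>M)))" for k
          by (simp only: S_def sum_distrib_left right_diff_distrib)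
        moreover have "(\<Sum>i=1..n. exp (\<mu> * x i) - (\<integral>y. exp (\<mu> * y) \<partial>M))
            = (\<Sum>i=1..n. exp (\<mu> * x i)) - real n * (exp (\<mu>\<^sup>2 / 2) * cosh (\<mu> * t))"
          by (simp add: sum_subtractf mgf(2))
        ultimately have sums: "(\<lambda>k. \<mu> ^ k / fact k * S k x) sums
            ((\<Sum>i=1..n. exp (\<mu> * x i)) - real n * (exp (\<mu>\<^sup>2 / 2) * cosh (\<mu> * t)))"
          by (simp only:)
        \<comment> \<open>The zeroth moment is the total mass 1 and does not fluctuate, so the
          series starts at order one.\<close>
        have "S 0 x = 0" by (simp add: S_def M.prob_space)
        from power_series_deviation[OF b \<mu> this sg[unfolded g_def[abs_def]] sums]
        have "\<bar>(\<Sum>i=1..n. exp (\<mu> * x i)) - real n * (exp (\<mu>\<^sup>2 / 2) * cosh (\<mu> * t)) - \<mu> * S 1 x\<bar> \<le> \<mu>\<^sup>2 * (w / b\<^sup>2)"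
          by (simp only: g_def w_def)
        also have "\<dots> \<le> \<mu>\<^sup>2 * V" using V1 by (intro mult_left_mono) auto
        finally show ?thesis .
      qed
      have "\<bar>S 1 x\<bar> \<le> V" using S1 V1 by linarith
      then show ?thesis
        unfolding deviation_control_def using V count dev
        by (intro exI[of _ "S 1 x"] exI[of _ V] conjI ballI allI impI)
    qed
    show "\<exists>G\<in>sets (sample_law (sym_mix t) n). 1 / 2 \<le> measure (sample_law (sym_mix t) n) G \<and>
        (\<forall>x\<in>G. deviation_control b t (q0 / 2) L n x)"
      unfolding P_eq using G_sets G_prob G_good by blast
  qed
qed

section \<open>Hellinger distance and model selection\<close>

lemma sq_diff_sqrt_le:
  fixes u v :: real
  assumes "0 \<le> u" "0 \<le> v"
  shows "(sqrt u - sqrt v)\<^sup>2 \<le> u + v"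
  using assms by (simp add: power2_diff)

lemma integrable_sq_diff_sqrt:
  assumes f: "integrable lborel f" "\<And>x. 0 \<le> f x" and g: "integrable lborel g" "\<And>x. 0 \<le> g x"
  shows "integrable lborel (\<lambda>x. (sqrt (f x) - sqrt (g x))\<^sup>2)"
proof (rule Bochner_Integration.integrable_bound)
  show "integrable lborel (\<lambda>x. f x + g x)" using f g by simp
  have [measurable]: "f \<in> borel_measurable borel" "g \<in> borel_measurable borel"
    using f(1) g(1) by (simp_all add: integrable_iff_bounded)
  show "(\<lambda>x. (sqrt (f x) - sqrt (g x))\<^sup>2) \<in> borel_measurable lborel" by measurable
  show "AE x in lborel. norm ((sqrt (f x) - sqrt (g x))\<^sup>2) \<le> norm (f x + g x)"
    using f(2) g(2) sq_diff_sqrt_le by simp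
qed

lemma hellinger_sq: "(hellinger f g)\<^sup>2 = 1 / 2 * (\<integral>x. (sqrt (f x) - sqrt (g x))\<^sup>2 \<partial>lborel)"
  by (simp add: hellinger_def integral_nonneg)

lemma hellinger_sq_le_one:
  assumes f: "has_bochner_integral lborel f 1" "\<And>x. 0 \<le> f x"
    and g: "has_bochner_integral lborel g 1" "\<And>x. 0 \<le> g x"
  shows "(hellinger f g)\<^sup>2 \<le> 1"
proof -
  have f1: "integrable lborel f" "(\<integral>x. f x \<partial>lborel) = 1" and g1: "integrable lborel g" "(\<integral>x. g x \<partial>lborel) = 1"
    using f g by (simp_all add: has_bochner_integral_iff)
  have "(\<integral>x. (sqrt (f x) - sqrt (g x))\<^sup>2 \<partial>lborel) \<le> (\<integral>x. f x + g x \<partial>lborel)"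
    by (intro integral_mono integrable_sq_diff_sqrt Bochner_Integration.integrable_add sq_diff_sqrt_le f1 g1 f(2) g(2))
  also have "\<dots> = 2" using f1 g1 by simp
  finally show ?thesis by (simp add: hellinger_sq)
qed

text \<open>Factor \<open>g - f\<close> into the difference and the sum of the square roots and
  separate the factors by a weighted arithmetic-geometric mean inequality. The difference yields the
  Hellinger term, the sum only second moments of \<open>h\<close>.\<close>

lemma hellinger_ge_test_function:
  fixes f g h :: "real \<Rightarrow> real"
  assumes f: "integrable lborel f" "\<And>x. 0 \<le> f x" and g: "integrable lborel g" "\<And>x. 0 \<le> g x"
    and hf: "integrable lborel (\<lambda>x. f x * h x)" and hg: "integrable lborel (\<lambda>x. g x * h x)"
    and hf2: "integrable lborel (\<lambda>x. f x * (h x)\<^sup>2)" and hg2: "integrable lborel (\<lambda>x. g x * (h x)\<^sup>2)"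
    and G: "(\<integral>x. f x * (h x)\<^sup>2 \<partial>lborel) + (\<integral>x. g x * (h x)\<^sup>2 \<partial>lborel) \<le> G" "G > 0"
    and D: "0 < D" "D \<le> (\<integral>x. g x * h x \<partial>lborel) - (\<integral>x. f x * h x \<partial>lborel)"
  shows "D\<^sup>2 \<le> 4 * G * (hellinger f g)\<^sup>2"
proof -
  \<comment> \<open>This weight makes \<open>1 / c * G\<close> equal to \<open>D / 2\<close>, which
    the left side absorbs.\<close>
  define c where "c = 2 * G / D"
  have c: "c > 0" using G D by (simp add: c_def)
  have pt: "g x * h x - f x * h x
      \<le> c / 2 * (sqrt (f x) - sqrt (g x))\<^sup>2 + 1 / c * (f x * (h x)\<^sup>2 + g x * (h x)\<^sup>2)" for x
  proof -
    define u v where "u = sqrt (f x)" and "v = sqrt (g x)"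
    have uv: "f x = u\<^sup>2" "g x = v\<^sup>2" using f(2) g(2) by (simp_all add: u_def v_def)
    have "g x * h x - f x * h x = (v - u) * (h x * (u + v))"
      by (simp add: uv power2_eq_square algebra_simps)
    also have "\<dots> \<le> c / 2 * (v - u)\<^sup>2 + (h x * (u + v))\<^sup>2 / (4 * (c / 2))"
      using linear_minus_quadratic_le[of "c / 2" "h x * (u + v)" "v - u"] c by (simp add: mult.commute)
    also have "(h x * (u + v))\<^sup>2 \<le> (h x)\<^sup>2 * (2 * (u\<^sup>2 + v\<^sup>2))"
      unfolding power_mult_distrib using sum_squares_bound[of u v]
      by (intro mult_left_mono) (auto simp: power2_sum)
    then have "(h x * (u + v))\<^sup>2 / (4 * (c / 2)) \<le> (h x)\<^sup>2 * (2 * (u\<^sup>2 + v\<^sup>2)) / (4 * (c / 2))"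
      using c by (intro divide_right_mono) auto
    also have "\<dots> = 1 / c * (f x * (h x)\<^sup>2 + g x * (h x)\<^sup>2)"
      using c by (simp add: uv field_simps)
    finally show ?thesis by (simp add: u_def v_def power2_commute)
  qed
  have "D \<le> (\<integral>x. g x * h x - f x * h x \<partial>lborel)"
    using hf hg D by simp
  also have "\<dots> \<le> (\<integral>x. c / 2 * (sqrt (f x) - sqrt (g x))\<^sup>2 + 1 / c * (f x * (h x)\<^sup>2 + g x * (h x)\<^sup>2) \<partial>lborel)"
    using hf hg hf2 hg2 integrable_sq_diff_sqrt[OF f g]
    by (intro integral_mono pt Bochner_Integration.integrable_add Bochner_Integration.integrable_diff
        integrable_mult_right)
  also have "\<dots> = c * (hellinger f g)\<^sup>2
      + 1 / c * ((\<integral>x. f x * (h x)\<^sup>2 \<partial>lborel) + (\<integral>x. g x * (h x)\<^sup>2 \<partial>lborel))"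
    using hf2 hg2 integrable_sq_diff_sqrt[OF f g] by (simp add: hellinger_sq)
  also have "\<dots> \<le> c * (hellinger f g)\<^sup>2 + 1 / c * G"
    using G c by (intro add_left_mono mult_left_mono) auto
  finally have "D * D \<le> D * (c * (hellinger f g)\<^sup>2 + 1 / c * G)"
    using D by (intro mult_left_mono) auto
  also have "\<dots> = 2 * G * (hellinger f g)\<^sup>2 + D * D / 2"
    using G D by (simp add: c_def field_simps)
  finally show ?thesis by (simp add: power2_eq_square)
qed

text \<open>The test function is \<open>exp (a * x)\<close> with \<open>a\<close> of modulus 1 and
  \<open>a * \<mu> \<le> 0\<close>. The normal law then has mean at most \<open>exp (1 / 2)\<close>,
  the mixture \<open>exp (1 / 2) * cosh t\<close>, so a gap of order \<open>t\<^sup>2\<close> holds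
  for every \<mu>.\<close>

lemma hellinger_normal_sym_mix_ge:
  assumes t: "0 < t" "t \<le> b" and \<mu>: "\<bar>\<mu>\<bar> \<le> b"
  shows "t ^ 4 / (128 * exp (2 * b + 2)) \<le> (hellinger (normal_density \<mu> 1) (sym_mix t))\<^sup>2"
proof -
  define a where "a = (if 0 \<le> \<mu> then - 1 else 1 :: real)"
  have a: "a\<^sup>2 = 1" "(a + a)\<^sup>2 = 4" "a * \<mu> \<le> 0" "(a + a) * \<mu> \<le> 2 * b"
    and cosh_a: "cosh (a * t) = cosh t" "cosh ((a + a) * t) = cosh (2 * t)"
    using \<mu> by (auto simp: a_def)
  define h where "h x = exp (a * x)" for x
  have h2: "(h x)\<^sup>2 = exp ((a + a) * x)" for x
    by (simp add: h_def power2_eq_square distrib_right flip: exp_add)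
  note n = normal_density_mgf[of \<mu>, unfolded has_bochner_integral_iff]
  note s = sym_mix_mgf[of t, unfolded has_bochner_integral_iff]
  \<comment> \<open>Bounds the sum of the second moments of \<open>h\<close>, that is, of both
    moment generating functions at \<open>a + a\<close>.\<close>
  define G where "G = 2 * exp (2 * b + 2)"
  have G_le: "exp ((a + a) * \<mu> + (a + a)\<^sup>2 / 2) + exp ((a + a)\<^sup>2 / 2) * cosh ((a + a) * t) \<le> G"
  proof -
    have "cosh (2 * t) \<le> exp (2 * t)" using t by (simp add: cosh_def)
    also have "\<dots> \<le> exp (2 * b)" using t by simp
    finally have 1: "exp 2 * cosh (2 * t) \<le> exp 2 * exp (2 * b)" by simp
    have 2: "exp ((a + a) * \<mu>) * exp 2 \<le> exp (2 * b) * exp 2"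
      using a(4) by (intro mult_right_mono) simp_all
    have 3: "exp ((a + a) * \<mu> + (a + a)\<^sup>2 / 2) = exp ((a + a) * \<mu>) * exp 2"
      unfolding a by (simp flip: exp_add)
    have 4: "exp ((a + a)\<^sup>2 / 2) = exp 2" unfolding a by simp
    have 5: "G = exp (2 * b) * exp 2 + exp 2 * exp (2 * b)" by (simp add: G_def exp_add)
    show ?thesis unfolding 3 4 5 cosh_a by (rule add_mono[OF 2 1])
  qed
  have D_le: "t\<^sup>2 / 4 \<le> exp (a\<^sup>2 / 2) * cosh (a * t) - exp (a * \<mu> + a\<^sup>2 / 2)"
  proof -
    \<comment> \<open>Averaging a quadratic bound at \<open>t\<close> with a linear one at
      \<open>- t\<close> leaves the coefficient 1/4.\<close>
    have "1 + t + t\<^sup>2 / 2 \<le> exp t" using t by (intro exp_lower_Taylor_quadratic) auto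
    moreover have "1 + - t \<le> exp (- t)" by (rule exp_ge_add_one_self)
    ultimately have 1: "t\<^sup>2 / 4 \<le> cosh t - 1" by (simp add: cosh_def field_simps)
    then have "1 * (t\<^sup>2 / 4) \<le> exp (1 / 2) * (cosh t - 1)" by (intro mult_mono) auto
    also have "\<dots> \<le> exp (1 / 2) * (cosh t - exp (a * \<mu>))"
      using a(3) by (intro mult_left_mono) auto
    finally show ?thesis unfolding a cosh_a by (simp add: exp_add algebra_simps)
  qed
  have "(t\<^sup>2 / 4)\<^sup>2 \<le> 4 * G * (hellinger (normal_density \<mu> 1) (sym_mix t))\<^sup>2"
  proof (rule hellinger_ge_test_function)
    show "integrable lborel (sym_mix t)" using s[of 0] by simp
    show "(\<integral>x. normal_density \<mu> 1 x * (h x)\<^sup>2 \<partial>lborel) + (\<integral>x. sym_mix t x * (h x)\<^sup>2 \<partial>lborel) \<le> G"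
      unfolding h2 using n s G_le by simp
    show "t\<^sup>2 / 4 \<le> (\<integral>x. sym_mix t x * h x \<partial>lborel) - (\<integral>x. normal_density \<mu> 1 x * h x \<partial>lborel)"
      unfolding h_def using n s D_le by simp
    show "integrable lborel (\<lambda>x. normal_density \<mu> 1 x * (h x)\<^sup>2)" unfolding h2 using n by simp
    show "integrable lborel (\<lambda>x. sym_mix t x * (h x)\<^sup>2)" unfolding h2 using s by simp
  qed (use t n s in \<open>auto simp: h_def G_def\<close>)
  then show ?thesis by (simp add: G_def power_divide field_simps)
qed

section \<open>Model densities and sample laws\<close>

lemma model_mixture:
  assumes f: "f \<in> M1 b \<union> M2 b p" and p: "0 < p"
  obtains \<pi> \<mu>1 \<mu>2 where "0 \<le> \<pi>" "\<pi> \<le> 1" "\<bar>\<mu>1\<bar> \<le> b" "\<bar>\<mu>2\<bar> \<le> b"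
    "f = (\<lambda>x. \<pi> * normal_density \<mu>1 1 x + (1 - \<pi>) * normal_density \<mu>2 1 x)"
  using f
proof
  assume "f \<in> M1 b"
  then obtain \<mu> where \<mu>: "f = normal_density \<mu> 1" "\<bar>\<mu>\<bar> \<le> b" by (auto simp: M1_def abs_le_iff)
  \<comment> \<open>A single normal density is a degenerate mixture of weight 1, so both models
    share one representation.\<close>
  show thesis by (rule that[of 1 \<mu> \<mu>]) (use \<mu> in auto)
next
  assume "f \<in> M2 b p"
  then obtain \<pi> \<mu>1 \<mu>2 where *: "\<pi> \<in> {p..1 - p}" "\<mu>1 \<in> {-b..b}" "\<mu>2 \<in> {-b..b}"
    "f = (\<lambda>x. \<pi> * normal_density \<mu>1 1 x + (1 - \<pi>) * normal_density \<mu>2 1 x)"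
    by (auto simp: M2_def)
  show thesis by (rule that[of \<pi> \<mu>1 \<mu>2]) (use * p in auto)
qed

lemma mixture_density:
  assumes "0 \<le> \<pi>" "\<pi> \<le> 1"
  shows "has_bochner_integral lborel (\<lambda>x. \<pi> * normal_density \<mu>1 1 x + (1 - \<pi>) * normal_density \<mu>2 1 x) 1"
    and "0 \<le> \<pi> * normal_density \<mu>1 1 x + (1 - \<pi>) * normal_density \<mu>2 1 x"
proof -
  have "has_bochner_integral lborel (normal_density \<mu> 1) 1" for \<mu>
    by (simp add: has_bochner_integral_iff)
  then have "has_bochner_integral lborel (\<lambda>x. \<pi> * normal_density \<mu>1 1 x + (1 - \<pi>) * normal_density \<mu>2 1 x)
      (\<pi> * 1 + (1 - \<pi>) * 1)"
    by (intro has_bochner_integral_add has_bochner_integral_mult_right)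
  then show "has_bochner_integral lborel (\<lambda>x. \<pi> * normal_density \<mu>1 1 x + (1 - \<pi>) * normal_density \<mu>2 1 x) 1"
    by simp
qed (use assms in simp)

lemma model_density:
  assumes "f \<in> M1 b \<union> M2 b p" "0 < p"
  shows "has_bochner_integral lborel f 1" "0 \<le> f x"
  using model_mixture[OF assms] mixture_density by metis+

lemma hellinger_sq_model_le_one:
  assumes "f \<in> M1 b \<union> M2 b p" "g \<in> M1 b \<union> M2 b p" "0 < p"
  shows "(hellinger f g)\<^sup>2 \<le> 1"
  using assms by (intro hellinger_sq_le_one model_density)

lemma sets_sample_law: "sets (sample_law f n) = sets (sample_space n)"
  unfolding sample_law_def sample_space_def by (intro sets_PiM_cong) auto

lemma space_sample_law: "space (sample_law f n) = space (sample_space n)"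
  by (rule sets_eq_imp_space_eq[OF sets_sample_law])

lemma prob_space_sample_law:
  assumes "f \<in> M1 b \<union> M2 b p" "0 < p"
  shows "prob_space (sample_law f n)"
proof -
  have "has_bochner_integral lborel f 1" "\<And>x. 0 \<le> f x" using model_density[OF assms] by auto
  then have "(\<integral>\<^sup>+x. ennreal (f x) \<partial>lborel) = 1" and [measurable]: "f \<in> borel_measurable borel"
    by (auto simp: has_bochner_integral_iff nn_integral_eq_integral integrable_iff_bounded)
  then have "prob_space (density lborel (\<lambda>x. ennreal (f x)))"
    by (intro prob_spaceI) (simp add: emeasure_density)
  then show ?thesis unfolding sample_law_def by (intro prob_space_PiM)
qed

section \<open>Selection of the smaller model and its risk\<close>

lemma post_selection_in_model:
  assumes "is_mle b p fhat" "n \<ge> 1" "x \<in> space (sample_space n)"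
  shows "post_selection pen fhat n x \<in> M1 b \<union> M2 b p"
    and "khat pen fhat n x = 1 \<Longrightarrow> post_selection pen fhat n x \<in> M1 b"
    and "neg_loglik n x (fhat 1 n x) + pen 1 n \<le> neg_loglik n x (fhat 2 n x) + pen 2 n \<Longrightarrow> khat pen fhat n x = 1"
proof -
  define A where "A = {k. is_arg_min (\<lambda>k. neg_loglik n x (fhat k n x) + pen k n) (\<lambda>k. k \<in> {1, 2}) k}"
  have sub: "A \<subseteq> {1, 2}" by (auto simp: A_def is_arg_min_def)
  then have fin: "finite A" by (rule finite_subset) simp
  have "1 \<in> A \<or> 2 \<in> A" unfolding A_def is_arg_min_def by force
  then have ne: "A \<noteq> {}" by auto
  have k: "khat pen fhat n x = Min A" by (simp add: khat_def A_def)
  have k12: "khat pen fhat n x \<in> {1, 2}" using Min_in[OF fin ne] sub k by auto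
  have mem: "fhat k n x \<in> model b p k" if "k \<in> {1, 2}" for k
    using assms that unfolding is_mle_def is_arg_min_def by blast
  show "post_selection pen fhat n x \<in> M1 b \<union> M2 b p"
    using mem[OF k12] unfolding post_selection_def model_def by (auto split: if_splits)
  show "post_selection pen fhat n x \<in> M1 b" if "khat pen fhat n x = 1"
    using mem[of 1] that by (simp add: post_selection_def model_def)
  \<comment> \<open>Ties go to the smaller index, so the non-strict inequality is enough.\<close>
  assume "neg_loglik n x (fhat 1 n x) + pen 1 n \<le> neg_loglik n x (fhat 2 n x) + pen 2 n"
  then have "1 \<in> A" by (auto simp: A_def is_arg_min_def)
  moreover have "1 \<le> a" if "a \<in> A" for a using that sub by auto
  ultimately show "khat pen fhat n x = 1" unfolding k using fin by (intro Min_eqI) auto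
qed

text \<open>The fit in \<open>M1\<close> is at least as good as N(0,1), so the fits differ by at
  most the log-likelihood ratio of the larger fit against N(0,1). That fit depends on the data,
  hence the bound over all mixtures.\<close>

lemma khat_eq_one:
  assumes mle: "is_mle b p fhat" and n: "n \<ge> 1" and x: "x \<in> space (sample_space n)" and b: "b > 0" and p: "0 < p"
    and bound: "\<And>\<pi> \<mu>1 \<mu>2. \<lbrakk>0 \<le> \<pi>; \<pi> \<le> 1; \<bar>\<mu>1\<bar> \<le> b; \<bar>\<mu>2\<bar> \<le> b\<rbrakk> \<Longrightarrow>
      (\<Sum>i=1..n. ln (mix_tilt \<pi> \<mu>1 \<mu>2 (x i))) \<le> real n * (pen 2 n - pen 1 n)"
  shows "khat pen fhat n x = 1"
proof (rule post_selection_in_model(3)[OF mle n x])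
  have "fhat 2 n x \<in> model b p 2"
    using mle n x unfolding is_mle_def is_arg_min_def by blast
  then have "fhat 2 n x \<in> M1 b \<union> M2 b p" by (simp add: model_def)
  then obtain \<pi> \<mu>1 \<mu>2 where \<pi>: "0 \<le> \<pi>" "\<pi> \<le> 1" and \<mu>: "\<bar>\<mu>1\<bar> \<le> b" "\<bar>\<mu>2\<bar> \<le> b"
    and f2: "fhat 2 n x = (\<lambda>x. \<pi> * normal_density \<mu>1 1 x + (1 - \<pi>) * normal_density \<mu>2 1 x)"
    using p by (rule model_mixture)
  have ln2: "ln (fhat 2 n x y) = ln (mix_tilt \<pi> \<mu>1 \<mu>2 y) + ln (normal_density 0 1 y)" for y
  proof -
    have "fhat 2 n x y = mix_tilt \<pi> \<mu>1 \<mu>2 y * normal_density 0 1 y"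
      unfolding f2 by (simp add: normal_density_tilt[of \<mu>1] normal_density_tilt[of \<mu>2] mix_tilt_def algebra_simps)
    then show ?thesis
      using mix_tilt_pos[OF \<pi>] normal_density_pos[of 1 0 y] by (simp add: ln_mult_pos)
  qed
  have "normal_density 0 1 \<in> model b p 1"
    using b by (auto simp: model_def M1_def)
  then have "neg_loglik n x (fhat 1 n x) \<le> neg_loglik n x (normal_density 0 1)"
    using mle n x unfolding is_mle_def is_arg_min_def by (meson insertI1 not_less)
  also have "\<dots> = neg_loglik n x (fhat 2 n x) + (\<Sum>i=1..n. ln (mix_tilt \<pi> \<mu>1 \<mu>2 (x i))) / real n"
    unfolding neg_loglik_def ln2 by (simp add: sum.distrib add_divide_distrib)
  also have "(\<Sum>i=1..n. ln (mix_tilt \<pi> \<mu>1 \<mu>2 (x i))) / real n \<le> pen 2 n - pen 1 n"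
    using bound[OF \<pi> \<mu>] n by (simp add: divide_le_eq mult.commute)
  finally show "neg_loglik n x (fhat 1 n x) + pen 1 n \<le> neg_loglik n x (fhat 2 n x) + pen 2 n"
    by simp
qed

lemma sym_mix_in_M2:
  assumes "0 \<le> t" "t \<le> b" "0 < p" "p < 1 / 2"
  shows "sym_mix t \<in> M2 b p"
proof -
  have "sym_mix t = (\<lambda>x. 1 / 2 * normal_density (- t) 1 x + (1 - 1 / 2) * normal_density t 1 x)"
    by (simp only: sym_mix_def[abs_def])
  moreover have "1 / 2 \<in> {p..1 - p}" "- t \<in> {-b..b}" "t \<in> {-b..b}" "- t \<le> t"
    using assms by auto
  ultimately show ?thesis unfolding M2_def by blast
qed

text \<open>The loss is at most 1. This makes it integrable and bounds the set of risks, as the real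
  supremum requires.\<close>

lemma
  assumes mle: "is_mle b p fhat" and meas: "measurable_selection b p pen fhat" and n: "n \<ge> 1"
    and f0: "f0 \<in> M1 b \<union> M2 b p" and p: "0 < p"
  shows loss_integrable: "integrable (sample_law f0 n) (\<lambda>x. (hellinger (post_selection pen fhat n x) f0)\<^sup>2)"
    and risk_le_one: "risk pen fhat n f0 \<le> 1"
proof -
  interpret prob_space "sample_law f0 n" using f0 p by (rule prob_space_sample_law)
  have le: "(hellinger (post_selection pen fhat n x) f0)\<^sup>2 \<le> 1" if "x \<in> space (sample_law f0 n)" for x
    using that post_selection_in_model(1)[OF mle n] f0 p
    by (intro hellinger_sq_model_le_one) (auto simp: space_sample_law)
  have "(\<lambda>x. (hellinger (post_selection pen fhat n x) f0)\<^sup>2) \<in> borel_measurable (sample_space n)"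
    using meas n f0 unfolding measurable_selection_def by blast
  then have "(\<lambda>x. (hellinger (post_selection pen fhat n x) f0)\<^sup>2) \<in> borel_measurable (sample_law f0 n)"
    by (simp cong: measurable_cong_sets add: sets_sample_law)
  then show int: "integrable (sample_law f0 n) (\<lambda>x. (hellinger (post_selection pen fhat n x) f0)\<^sup>2)"
    using le by (intro integrable_const_bound[where B = 1] AE_I2) auto
  show "risk pen fhat n f0 \<le> 1"
    unfolding risk_def using int le by (intro integral_le_const AE_I2) auto
qed

text \<open>The loss is discarded off \<open>G\<close> and bounded below on \<open>G\<close> by the
  distance to \<open>M1\<close>; the probability 1/2 turns 128 into 256.\<close>

lemma risk_sym_mix_ge:
  assumes mle: "is_mle b p fhat" and meas: "measurable_selection b p pen fhat" and n: "n \<ge> 1"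
    and t: "0 < t" "t \<le> b" and p: "0 < p" "p < 1 / 2"
    and G: "G \<in> sets (sample_law (sym_mix t) n)" "1 / 2 \<le> measure (sample_law (sym_mix t) n) G"
    and khat: "\<And>x. x \<in> G \<Longrightarrow> khat pen fhat n x = 1"
  shows "t ^ 4 / (256 * exp (2 * b + 2)) \<le> risk pen fhat n (sym_mix t)"
proof -
  define c where "c = t ^ 4 / (128 * exp (2 * b + 2))"
  have f0: "sym_mix t \<in> M1 b \<union> M2 b p" using sym_mix_in_M2[of t b p] t p by simp
  interpret prob_space "sample_law (sym_mix t) n" using f0 p(1) by (rule prob_space_sample_law)
  have "c * (1 / 2) \<le> c * prob G" using G(2) by (intro mult_left_mono) (auto simp: c_def)
  also have "\<dots> = expectation (\<lambda>x. c * indicator G x)" using G(1) by simp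
  also have "\<dots> \<le> risk pen fhat n (sym_mix t)"
    unfolding risk_def
  proof (rule integral_mono[OF _ loss_integrable[OF mle meas n f0 p(1)]])
    show "integrable (sample_law (sym_mix t) n) (\<lambda>x. c * indicator G x)"
      using G(1) by (intro integrable_mult_right) (auto simp: less_top[symmetric])
    fix x assume x: "x \<in> space (sample_law (sym_mix t) n)"
    show "c * indicator G x \<le> (hellinger (post_selection pen fhat n x) (sym_mix t))\<^sup>2"
    proof (cases "x \<in> G")
      case True
      then have "post_selection pen fhat n x \<in> M1 b"
        using post_selection_in_model(2)[OF mle n] x khat by (simp add: space_sample_law)
      then obtain \<mu> where "post_selection pen fhat n x = normal_density \<mu> 1" "\<bar>\<mu>\<bar> \<le> b"
        by (auto simp: M1_def abs_le_iff)
      then show ?thesis using hellinger_normal_sym_mix_ge[OF t] True by (simp add: c_def)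
    qed simp
  qed
  finally show ?thesis by (simp add: c_def)
qed

theorem proposition18:
  fixes b p :: real
  assumes "b > 0" and "0 < p" and "p < 1 / 2"
  shows "\<exists>c>0. \<forall>(pen :: nat \<Rightarrow> nat \<Rightarrow> real) (fhat :: estimators).
           is_mle b p fhat \<longrightarrow>
           measurable_selection b p pen fhat \<longrightarrow>
           (\<lambda>n. pen 2 n - pen 1 n) \<longlonglongrightarrow> 0 \<longrightarrow>
           filterlim (\<lambda>n. real n * (pen 2 n - pen 1 n)) at_top sequentially \<longrightarrow>
           (\<forall>\<^sub>F n in sequentially.
              (SUP f0 \<in> M1 b \<union> M2 b p. risk pen fhat n f0) \<ge> c * (pen 2 n - pen 1 n))"
proof -
  note b = assms(1) and p = assms(2,3)
  obtain q N L where q: "q > 0" and event: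
    "\<And>t n. \<lbrakk>0 \<le> t; t \<le> b; n \<ge> N; n \<ge> 1\<rbrakk> \<Longrightarrow>
      \<exists>G\<in>sets (sample_law (sym_mix t) n). 1 / 2 \<le> measure (sample_law (sym_mix t) n) G \<and>
        (\<forall>x\<in>G. deviation_control b t q L n x)"
    using deviation_event[OF b] by blast
  obtain A where A: "A > 0" and llr:
    "\<And>t n xs L \<pi> \<mu>1 \<mu>2. \<lbrakk>0 \<le> t; t \<le> b; n \<ge> 1; 0 \<le> \<pi>; \<pi> \<le> 1; \<bar>\<mu>1\<bar> \<le> b; \<bar>\<mu>2\<bar> \<le> b;
       deviation_control b t q L n xs\<rbrakk> \<Longrightarrow>
       (\<Sum>i=1..n. ln (mix_tilt \<pi> \<mu>1 \<mu>2 (xs i))) \<le> A * (real n * t ^ 4 + L\<^sup>2)"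
    using log_likelihood_ratio_bound[OF b q] by blast
  \<comment> \<open>The risk bound at \<open>t ^ 4 = \<Delta> / (2 * A)\<close>, divided by
    \<Delta>; it is fixed before penalties and estimators.\<close>
  define c where "c = 1 / (2 * A) / (256 * exp (2 * b + 2))"
  have c: "c > 0" using A by (simp add: c_def)
  show ?thesis
  proof (intro exI[of _ c] conjI c allI impI)
    fix pen :: "nat \<Rightarrow> nat \<Rightarrow> real" and fhat :: estimators
    define \<Delta> where "\<Delta> n = pen 2 n - pen 1 n" for n
    assume mle: "is_mle b p fhat" and meas: "measurable_selection b p pen fhat"
      and "(\<lambda>n. pen 2 n - pen 1 n) \<longlonglongrightarrow> 0"
      and "filterlim (\<lambda>n. real n * (pen 2 n - pen 1 n)) at_top sequentially"
    then have lim0: "\<Delta> \<longlonglongrightarrow> 0" and liminf: "filterlim (\<lambda>n. real n * \<Delta> n) at_top sequentially"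
      by (simp_all add: \<Delta>_def[abs_def])
    \<comment> \<open>The vanishing penalty difference keeps \<open>t\<close> below
      \<open>b\<close>; the divergence of \<open>n * \<Delta>\<close> makes
      \<open>A * L\<^sup>2\<close> at most half of it.\<close>
    have "\<forall>\<^sub>F n in sequentially. \<Delta> n < 2 * A * b ^ 4"
      using lim0 by (rule order_tendstoD) (use A b in simp)
    moreover have "\<forall>\<^sub>F n in sequentially. 2 * A * L\<^sup>2 + 1 \<le> real n * \<Delta> n"
      using liminf by (simp add: filterlim_at_top)
    moreover note eventually_ge_at_top[of N] eventually_ge_at_top[of 1]
    ultimately show "\<forall>\<^sub>F n in sequentially.
        c * (pen 2 n - pen 1 n) \<le> (SUP f0 \<in> M1 b \<union> M2 b p. risk pen fhat n f0)"
    proof eventually_elim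
      case (elim n)
      have "0 \<le> 2 * A * L\<^sup>2" using A by simp
      then have "0 < real n * \<Delta> n" using elim(2) by linarith
      then have \<Delta>: "\<Delta> n > 0" using elim(4) by (simp add: zero_less_mult_iff)
      \<comment> \<open>The separation at which \<open>A * n * t ^ 4\<close> uses exactly half of
        \<open>n * \<Delta>\<close>, leaving the other half for
        \<open>A * L\<^sup>2\<close>.\<close>
      define t where "t = root 4 (\<Delta> n / (2 * A))"
      have t4: "t ^ 4 = \<Delta> n / (2 * A)" using \<Delta> A by (simp add: t_def)
      have t0: "t > 0" using \<Delta> A by (simp add: t_def)
      have "t ^ 4 \<le> b ^ 4" unfolding t4 using elim(1) A by (simp add: divide_le_eq mult.commute)
      then have tb: "t \<le> b" using power_mono_iff[of t b 4] t0 b by simp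
      obtain G where G: "G \<in> sets (sample_law (sym_mix t) n)" "1 / 2 \<le> measure (sample_law (sym_mix t) n) G"
        and good: "\<And>x. x \<in> G \<Longrightarrow> deviation_control b t q L n x"
        using event[OF less_imp_le[OF t0] tb elim(3,4)] by blast
      have khat: "khat pen fhat n x = 1" if x: "x \<in> G" for x
      proof (rule khat_eq_one[OF mle elim(4) _ b p(1)])
        show "x \<in> space (sample_space n)"
          using sets.sets_into_space[OF G(1)] x by (auto simp: space_sample_law)
        fix \<pi> \<mu>1 \<mu>2 :: real
        assume \<pi>: "0 \<le> \<pi>" "\<pi> \<le> 1" and \<mu>: "\<bar>\<mu>1\<bar> \<le> b" "\<bar>\<mu>2\<bar> \<le> b"
        have "(\<Sum>i=1..n. ln (mix_tilt \<pi> \<mu>1 \<mu>2 (x i))) \<le> A * (real n * t ^ 4 + L\<^sup>2)"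
          by (rule llr[OF less_imp_le[OF t0] tb elim(4) \<pi> \<mu> good[OF x]])
        also have "\<dots> = real n * \<Delta> n / 2 + A * L\<^sup>2"
          using A by (simp add: t4 field_simps)
        also have "\<dots> \<le> real n * \<Delta> n" using elim(2) by simp
        finally show "(\<Sum>i=1..n. ln (mix_tilt \<pi> \<mu>1 \<mu>2 (x i))) \<le> real n * (pen 2 n - pen 1 n)"
          unfolding \<Delta>_def .
      qed
      have "c * (pen 2 n - pen 1 n) = t ^ 4 / (256 * exp (2 * b + 2))"
        unfolding t4 by (simp add: c_def \<Delta>_def)
      also have "\<dots> \<le> risk pen fhat n (sym_mix t)"
        by (rule risk_sym_mix_ge[OF mle meas elim(4) t0 tb p G khat])
      also have "\<dots> \<le> (SUP f0 \<in> M1 b \<union> M2 b p. risk pen fhat n f0)"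
      proof (rule cSUP_upper)
        show "sym_mix t \<in> M1 b \<union> M2 b p" using sym_mix_in_M2[of t b p] t0 tb p by simp
        show "bdd_above (risk pen fhat n ` (M1 b \<union> M2 b p))"
          using risk_le_one[OF mle meas elim(4) _ p(1)] by (intro bdd_aboveI2[where M = 1])
      qed
      finally show ?case .
    qed
  qed
qed

end
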